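(* Let $\alpha$ be a partial action of a unital inverse semigroup $G$ on a $C^*$-algebra $\mathcal{A}$, with $\alpha_g:D_{g^*}\to D_g$, and let $(\pi,u,\mathcal{H})$ be a covariant representation of $(\mathcal{A},G,\alpha)$. Let $S_G=\{(\alpha_{g_1}\cdots\alpha_{g_n},u_{g_1}\cdots u_{g_n}) : n\ge1,\ g_1,\dots,g_n\in G\}$ with coordinatewise multiplication, and let $\beta$ be the action of $S_G$ on $\mathcal{A}$ given, for $s=(\alpha_{g_1}\cdots\alpha_{g_n},u_{g_1}\cdots u_{g_n})$, by $E_s=D_{g_1}D_{g_1g_2}\cdots D_{g_1\cdots g_n}$ and $\beta_s=\alpha_{g_1}\cdots\alpha_{g_n}:E_{s^*}\to E_s$. Define $\nu:S_G\to B(\mathcal{H})$ by $\nu_s=u_{g_1}\cdots u_{g_n}$ for $s=(\alpha_{g_1}\cdots\alpha_{g_n},u_{g_1}\cdots u_{g_n})$. Then $(\pi,\nu,\mathcal{H})$ is a covariant representation of $(\mathcal{A},S_G,\beta)$. Conversely, if $(\rho,z,\mathcal{K})$ is a covariant representation of $(\mathcal{A},S_G,\beta)$, then the function $\omega:G\to B(\mathcal{K})$ defined by $\omega_g=z_{(\alpha_g,u_g)}$ gives a covariant representation $(\rho,\omega,\mathcal{K})$ of $(\mathcal{A},G,\alpha)$.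
   Context: $G$ is an inverse semigroup with unit $e$; $s^*$ denotes the inverse of $s$ in an inverse semigroup. A partial action $\alpha$ of $G$ on a $C^*$-algebra $\mathcal{A}$ consists of closed two-sided ideals $D_g$ of $\mathcal{A}$ ($g\in G$), with $D_e=\mathcal{A}$, and $*$-isomorphisms $\alpha_g:D_{g^*}\to D_g$ such that for all $s,t\in G$: (i) $\alpha_s^{-1}=\alpha_{s^*}$; (ii) $\alpha_s(D_{s^*}\cap D_t)=D_s\cap D_{st}$; (iii) $\alpha_s(\alpha_t(x))=\alpha_{st}(x)$ for all $x\in D_{t^*}\cap D_{t^*s^*}$. A product of closed ideals is the closed linear span of products, equivalently their intersection. The product $\alpha_{g_1}\cdots\alpha_{g_n}$ is the composition of partial maps on its largest possible domain. An action of a unital inverse semigroup $S$ on $\mathcal{A}$ consists of closed two-sided ideals $E_s$ ($s\in S$), with $E_{1}=\mathcal{A}$ for the unit $1$, and $*$-isomorphisms $\beta_s:E_{s^*}\to E_s$ with $\beta_s\beta_t=\beta_{st}$ as partial maps (composition on largest domain). An action is in particular a partial action, so the following definition applies to it too. The set $S_G$ is a unital inverse semigroup and $\beta$ is a well-defined action of it. A covariant representation of $(\mathcal{A},G,\alpha)$ is a triple $(\pi,u,\mathcal{H})$ where $\pi:\mathcal{A}\to B(\mathcal{H})$ is a non-degenerate ($*$-)representation on a Hilbert space $\mathcal{H}$ and, for each $g\in G$, $u_g$ is a partial isometry on $\mathcal{H}$ with initial space $\pi(D_{g^*})\mathcal{H}$ and final space $\pi(D_g)\mathcal{H}$, such that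 (1) $u_g\pi(a)u_{g^*}=\pi(\alpha_g(a))$ for $a\in D_{g^*}$; (2) $u_{st}h=u_su_th$ for all $h\in\pi(D_{t^*}D_{t^*s^*})\mathcal{H}$; (3) $u_{s^*}=u_s^*$. Here $\pi(I)\mathcal{H}=\{\pi(a)h: a\in I,h\in\mathcal{H}\}$, a closed subspace for every closed ideal $I$. *)

theory Defs
  imports "HOL-Analysis.Analysis" "HOL-Algebra.Group"
begin

section \<open>Complex normed spaces, \<open>C\<^sup>*\<close>-algebras and Hilbert spaces\<close>

class scaleC = scaleR +
  fixes scaleC :: "complex \<Rightarrow> 'a \<Rightarrow> 'a"  (infixr \<open>*\<^sub>C\<close> 75)
  assumes scaleR_scaleC: "r *\<^sub>R x = complex_of_real r *\<^sub>C x"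

class complex_vector = scaleC + real_vector +
  assumes scaleC_add_right: "c *\<^sub>C (x + y) = c *\<^sub>C x + c *\<^sub>C y"
    and scaleC_add_left: "(c + d) *\<^sub>C x = c *\<^sub>C x + d *\<^sub>C x"
    and scaleC_scaleC: "c *\<^sub>C d *\<^sub>C x = (c * d) *\<^sub>C x"
    and scaleC_one: "1 *\<^sub>C x = x"

global_interpretation complex_vector: vector_space "scaleC :: complex \<Rightarrow> 'a \<Rightarrow> 'a::complex_vector"
  defines csubspace = "module.subspace (scaleC :: complex \<Rightarrow> 'a \<Rightarrow> 'a::complex_vector)"
    and cspan = "module.span (scaleC :: complex \<Rightarrow> 'a \<Rightarrow> 'a::complex_vector)"
  by unfold_locales (simp_all add: scaleC_add_right scaleC_add_left scaleC_scaleC scaleC_one)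

class complex_normed_vector = complex_vector + real_normed_vector +
  assumes norm_scaleC: "norm (c *\<^sub>C x) = cmod c * norm x"

text \<open>Not necessarily unital.\<close>

class cstar_algebra = complex_normed_vector + real_normed_algebra + banach +
  fixes star :: "'a \<Rightarrow> 'a"
  assumes mult_scaleC_left: "(c *\<^sub>C x) * y = c *\<^sub>C (x * y)"
    and mult_scaleC_right: "x * (c *\<^sub>C y) = c *\<^sub>C (x * y)"
    and star_add: "star (x + y) = star x + star y"
    and star_scaleC: "star (c *\<^sub>C x) = cnj c *\<^sub>C star x"
    and star_mult: "star (x * y) = star y * star x"
    and star_star: "star (star x) = x"
    and cstar_identity: "norm (star x * x) = (norm x)\<^sup>2"

text \<open>Linear in the first argument.  Positive definiteness is part of \<open>cinner_self\<close>.\<close>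

class complex_hilbert = complex_normed_vector + banach +
  fixes cinner :: "'a \<Rightarrow> 'a \<Rightarrow> complex"
  assumes cinner_add_left: "cinner (x + y) z = cinner x z + cinner y z"
    and cinner_scaleC_left: "cinner (c *\<^sub>C x) y = c * cinner x y"
    and cinner_commute: "cinner y x = cnj (cinner x y)"
    and cinner_self: "cinner x x = complex_of_real ((norm x)\<^sup>2)"


section \<open>Ideals and star-isomorphisms between them\<close>

definition closed_ideal :: "'a::cstar_algebra set \<Rightarrow> bool" where
  "closed_ideal I \<longleftrightarrow> csubspace I \<and> closed I \<and> (\<forall>a. \<forall>x\<in>I. a * x \<in> I \<and> x * a \<in> I)"

definition ideal_product :: "'a::cstar_algebra set \<Rightarrow> 'a set \<Rightarrow> 'a set" where
  "ideal_product I J = closure (cspan {x * y | x y. x \<in> I \<and> y \<in> J})"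

fun ideal_products :: "'a::cstar_algebra set list \<Rightarrow> 'a set" where
  "ideal_products [] = UNIV"
| "ideal_products [I] = I"
| "ideal_products (I # J # Js) = ideal_product I (ideal_products (J # Js))"

text \<open>Maps between ideals are partial maps of the algebra, so that the library's \<open>\<circ>\<^sub>m\<close>
  is composition on the largest possible domain.\<close>

definition star_isomorphism_on ::
    "'a::cstar_algebra set \<Rightarrow> 'a set \<Rightarrow> ('a \<rightharpoonup> 'a) \<Rightarrow> bool" where
  "star_isomorphism_on I J f \<longleftrightarrow>
     dom f = I \<and> bij_betw (\<lambda>x. the (f x)) I J \<and>
     (\<forall>x\<in>I. \<forall>y\<in>I. the (f (x + y)) = the (f x) + the (f y)) \<and>
     (\<forall>c. \<forall>x\<in>I. the (f (c *\<^sub>C x)) = c *\<^sub>C the (f x)) \<and>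
     (\<forall>x\<in>I. \<forall>y\<in>I. the (f (x * y)) = the (f x) * the (f y)) \<and>
     (\<forall>x\<in>I. the (f (star x)) = star (the (f x)))"


section \<open>Operators and representations on Hilbert spaces\<close>

definition bounded_clinear :: "('h::complex_normed_vector \<Rightarrow> 'h) \<Rightarrow> bool" where
  "bounded_clinear T \<longleftrightarrow> bounded_linear T \<and> (\<forall>c x. T (c *\<^sub>C x) = c *\<^sub>C T x)"

definition is_adjoint :: "('h::complex_hilbert \<Rightarrow> 'h) \<Rightarrow> ('h \<Rightarrow> 'h) \<Rightarrow> bool" where
  "is_adjoint S T \<longleftrightarrow> (\<forall>x y. cinner (T x) y = cinner x (S y))"

definition orthogonal_complement :: "'h::complex_hilbert set \<Rightarrow> 'h set" where
  "orthogonal_complement X = {y. \<forall>x\<in>X. cinner x y = 0}"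

definition initial_space :: "('h::complex_hilbert \<Rightarrow> 'h) \<Rightarrow> 'h set" where
  "initial_space T = orthogonal_complement {h. T h = 0}"

definition partial_isometry :: "('h::complex_hilbert \<Rightarrow> 'h) \<Rightarrow> bool" where
  "partial_isometry T \<longleftrightarrow>
     bounded_clinear T \<and> (\<forall>h\<in>initial_space T. norm (T h) = norm h)"

abbreviation final_space :: "('h::complex_hilbert \<Rightarrow> 'h) \<Rightarrow> 'h set" where
  "final_space T \<equiv> range T"

definition star_representation :: "('a::cstar_algebra \<Rightarrow> 'h::complex_hilbert \<Rightarrow> 'h) \<Rightarrow> bool" where
  "star_representation \<pi> \<longleftrightarrow>
     (\<forall>a. bounded_clinear (\<pi> a)) \<and>
     (\<forall>a b h. \<pi> (a + b) h = \<pi> a h + \<pi> b h) \<and>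
     (\<forall>c a h. \<pi> (c *\<^sub>C a) h = c *\<^sub>C \<pi> a h) \<and>
     (\<forall>a b. \<pi> (a * b) = \<pi> a \<circ> \<pi> b) \<and>
     (\<forall>a. is_adjoint (\<pi> (star a)) (\<pi> a))"

definition rep_space :: "('a \<Rightarrow> 'h \<Rightarrow> 'h) \<Rightarrow> 'a set \<Rightarrow> 'h set" where
  "rep_space \<pi> I = {\<pi> a h | a h. a \<in> I}"

definition nondegenerate :: "('a \<Rightarrow> 'h::complex_hilbert \<Rightarrow> 'h) \<Rightarrow> bool" where
  "nondegenerate \<pi> \<longleftrightarrow> closure (cspan (rep_space \<pi> UNIV)) = UNIV"


section \<open>Unital inverse semigroups, partial actions, covariant representations\<close>

text \<open>This is the generalized inverse of semigroup theory, not the library's \<open>m_inv\<close>,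
  which refers to the unit.\<close>

definition semigroup_inverse :: "('g, 'm) monoid_scheme \<Rightarrow> 'g \<Rightarrow> 'g"
    (\<open>_\<^sup>\<star>\<index>\<close> [1000] 999) where
  "s\<^sup>\<star>\<^bsub>G\<^esub> = (THE t. t \<in> carrier G \<and> s \<otimes>\<^bsub>G\<^esub> t \<otimes>\<^bsub>G\<^esub> s = s \<and> t \<otimes>\<^bsub>G\<^esub> s \<otimes>\<^bsub>G\<^esub> t = t)"

locale unital_inverse_semigroup = monoid G for G (structure) +
  assumes unique_inverse: "s \<in> carrier G \<Longrightarrow>
    \<exists>!t. t \<in> carrier G \<and> s \<otimes> t \<otimes> s = s \<and> t \<otimes> s \<otimes> t = t"

locale partial_action = unital_inverse_semigroup G for G (structure) +
  fixes D :: "'a \<Rightarrow> 'b::cstar_algebra set"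
    and \<alpha> :: "'a \<Rightarrow> 'b \<rightharpoonup> 'b"
  assumes closed_ideal_D: "g \<in> carrier G \<Longrightarrow> closed_ideal (D g)"
    and D_one: "D \<one> = UNIV"
    and star_isomorphism: "g \<in> carrier G \<Longrightarrow> star_isomorphism_on (D (g\<^sup>\<star>)) (D g) (\<alpha> g)"
    and inverse: "s \<in> carrier G \<Longrightarrow> (Map.graph (\<alpha> s))\<inverse> = Map.graph (\<alpha> (s\<^sup>\<star>))"
    and image_Int: "\<lbrakk>s \<in> carrier G; t \<in> carrier G\<rbrakk> \<Longrightarrow>
      (\<lambda>x. the (\<alpha> s x)) ` (D (s\<^sup>\<star>) \<inter> D t) = D s \<inter> D (s \<otimes> t)"
    and comp: "\<lbrakk>s \<in> carrier G; t \<in> carrier G; x \<in> D (t\<^sup>\<star>) \<inter> D (t\<^sup>\<star> \<otimes> s\<^sup>\<star>)\<rbrakk> \<Longrightarrow>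
      (\<alpha> s \<circ>\<^sub>m \<alpha> t) x = \<alpha> (s \<otimes> t) x"

locale covariant_representation = partial_action G D \<alpha>
  for G (structure) and D :: "'a \<Rightarrow> 'b::cstar_algebra set" and \<alpha> +
  fixes \<pi> :: "'b \<Rightarrow> 'h::complex_hilbert \<Rightarrow> 'h"
    and u :: "'a \<Rightarrow> 'h \<Rightarrow> 'h"
  assumes representation: "star_representation \<pi>"
    and nondegenerate: "nondegenerate \<pi>"
    and partial_isometry: "g \<in> carrier G \<Longrightarrow> partial_isometry (u g)"
    and initial_space: "g \<in> carrier G \<Longrightarrow> initial_space (u g) = rep_space \<pi> (D (g\<^sup>\<star>))"
    and final_space: "g \<in> carrier G \<Longrightarrow> final_space (u g) = rep_space \<pi> (D g)"
    and covariance: "\<lbrakk>g \<in> carrier G; a \<in> D (g\<^sup>\<star>)\<rbrakk> \<Longrightarrow>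
      u g \<circ> \<pi> a \<circ> u (g\<^sup>\<star>) = \<pi> (the (\<alpha> g a))"
    and multiplicative: "\<lbrakk>s \<in> carrier G; t \<in> carrier G;
        h \<in> rep_space \<pi> (ideal_product (D (t\<^sup>\<star>)) (D (t\<^sup>\<star> \<otimes> s\<^sup>\<star>)))\<rbrakk> \<Longrightarrow>
      u (s \<otimes> t) h = u s (u t h)"
    and adjoint: "s \<in> carrier G \<Longrightarrow> is_adjoint (u (s\<^sup>\<star>)) (u s)"


section \<open>The inverse semigroup generated by a covariant representation\<close>

definition words :: "('g, 'm) monoid_scheme \<Rightarrow> 'g list set" where
  "words G = {gs. gs \<noteq> [] \<and> set gs \<subseteq> carrier G}"

definition word_element ::
    "('g \<Rightarrow> 'a \<rightharpoonup> 'a) \<Rightarrow> ('g \<Rightarrow> 'h \<Rightarrow> 'h) \<Rightarrow> 'g list \<Rightarrow> ('a \<rightharpoonup> 'a) \<times> ('h \<Rightarrow> 'h)" where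
  "word_element \<alpha> u gs = (foldr (\<lambda>g f. \<alpha> g \<circ>\<^sub>m f) gs Some, foldr (\<lambda>g T. u g \<circ> T) gs id)"

definition S_of :: "('g, 'm) monoid_scheme \<Rightarrow> ('g \<Rightarrow> 'a \<rightharpoonup> 'a) \<Rightarrow> ('g \<Rightarrow> 'h \<Rightarrow> 'h) \<Rightarrow>
    (('a \<rightharpoonup> 'a) \<times> ('h \<Rightarrow> 'h)) monoid" where
  "S_of G \<alpha> u =
     \<lparr>carrier = word_element \<alpha> u ` words G,
      mult = (\<lambda>s t. (fst s \<circ>\<^sub>m fst t, snd s \<circ> snd t)),
      one = (\<alpha> \<one>\<^bsub>G\<^esub>, u \<one>\<^bsub>G\<^esub>)\<rparr>"

definition word_ideal ::
    "('g, 'm) monoid_scheme \<Rightarrow> ('g \<Rightarrow> 'a::cstar_algebra set) \<Rightarrow> 'g list \<Rightarrow> 'a set" where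
  "word_ideal G D gs =
     ideal_products (map (\<lambda>k. D (foldr (\<otimes>\<^bsub>G\<^esub>) (take k gs) \<one>\<^bsub>G\<^esub>)) [1..<length gs + 1])"

text \<open>The description \<open>THE\<close> expresses that the ideal does not depend on the word chosen to
  represent \<open>s\<close>.\<close>

definition E_of :: "('g, 'm) monoid_scheme \<Rightarrow> ('g \<Rightarrow> 'a::cstar_algebra set) \<Rightarrow>
    ('g \<Rightarrow> 'a \<rightharpoonup> 'a) \<Rightarrow> ('g \<Rightarrow> 'h \<Rightarrow> 'h) \<Rightarrow> ('a \<rightharpoonup> 'a) \<times> ('h \<Rightarrow> 'h) \<Rightarrow> 'a set" where
  "E_of G D \<alpha> u s = (THE I. \<exists>gs\<in>words G. s = word_element \<alpha> u gs \<and> I = word_ideal G D gs)"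

text \<open>On a word \<open>s\<close>, the partial map \<open>\<alpha>\<^bsub>g1\<^esub> \<dots> \<alpha>\<^bsub>gn\<^esub>\<close> and the operator
  \<open>u\<^bsub>g1\<^esub> \<dots> u\<^bsub>gn\<^esub>\<close> are the coordinates of the pair \<open>s\<close>.\<close>

definition \<beta>_of :: "('a \<rightharpoonup> 'a) \<times> ('h \<Rightarrow> 'h) \<Rightarrow> 'a \<rightharpoonup> 'a" where
  "\<beta>_of s = fst s"

definition \<nu>_of :: "('a \<rightharpoonup> 'a) \<times> ('h \<Rightarrow> 'h) \<Rightarrow> 'h \<Rightarrow> 'h" where
  "\<nu>_of s = snd s"

end

theory Submission
  imports Defs
begin

text \<open>Every element of the generated semigroup is a pair \<open>(\<alpha>\<^bsub>w\<^esub>, u\<^bsub>w\<^esub>)\<close> for a word \<open>w\<close>.  Its range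
  ideal is the range of \<open>\<alpha>\<^bsub>w\<^esub>\<close>, because products of closed ideals are intersections.  The
  projections \<open>u\<^sub>g\<^sup>* u\<^sub>g\<close> commute with \<open>\<pi>\<close>, so the partial isometries \<open>u\<^sub>g\<close> can be multiplied: \<open>u\<^bsub>w\<^esub>\<close> is
  a partial isometry whose adjoint belongs to the reversed word of inverses and whose range is
  \<open>\<pi>(E)H\<close> for the range ideal \<open>E\<close> of \<open>\<alpha>\<^bsub>w\<^esub>\<close>.  For the converse, the product of \<open>(\<alpha>\<^sub>s, u\<^sub>s)\<close> and
  \<open>(\<alpha>\<^sub>t, u\<^sub>t)\<close> is \<open>(\<alpha>\<^bsub>st\<^esub>, u\<^bsub>st\<^esub>)\<close> times an idempotent, and that idempotent acts as the identity on
  the vectors in question.\<close>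

section \<open>Approximate units in closed ideals\<close>

lemma star_zero [simp]: "star (0::'a::cstar_algebra) = 0"
  using star_add[of 0 "0::'a"] by simp

lemma star_minus: "star (- x) = - star (x::'a::cstar_algebra)"
  using star_add[of "-x" x] by (simp add: eq_neg_iff_add_eq_0)

lemma star_diff: "star (x - y) = star x - star (y::'a::cstar_algebra)"
  using star_add[of x "-y"] by (simp add: star_minus)

lemma star_sum: "star (sum f A) = (\<Sum>x\<in>A. star (f x :: 'a::cstar_algebra))"
  by (induction A rule: infinite_finite_induct) (simp_all add: star_add)

lemma norm_star [simp]: "norm (star x) = norm (x::'a::cstar_algebra)"
proof -
  have le: "norm y \<le> norm (star y)" for y :: 'a
  proof (cases "y = 0")
    case False
    have "norm y * norm y \<le> norm (star y) * norm y"
      using cstar_identity[of y] norm_mult_ineq[of "star y" y] by (simp add: power2_eq_square)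
    then show ?thesis using False by simp
  qed simp
  show ?thesis using le[of x] le[of "star x"] by (simp add: star_star)
qed

lemma cstar_identity': "norm (x * star x) = (norm (x::'a::cstar_algebra))\<^sup>2"
  using cstar_identity[of "star x"] by (simp add: star_star)

context
  fixes I :: "'a::cstar_algebra set"
  assumes I: "closed_ideal I"
begin

lemma closed_ideal_csubspace: "csubspace I"
  using I by (simp add: closed_ideal_def)

lemma closed_ideal_closed: "closed I"
  using I by (simp add: closed_ideal_def)

lemma closed_ideal_zero: "0 \<in> I"
  using closed_ideal_csubspace by (rule complex_vector.subspace_0)

lemma closed_ideal_add: "x \<in> I \<Longrightarrow> y \<in> I \<Longrightarrow> x + y \<in> I"
  using closed_ideal_csubspace by (rule complex_vector.subspace_add)

lemma closed_ideal_scaleC: "x \<in> I \<Longrightarrow> c *\<^sub>C x \<in> I"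
  using closed_ideal_csubspace by (rule complex_vector.subspace_scale)

lemma closed_ideal_scaleR: "x \<in> I \<Longrightarrow> c *\<^sub>R x \<in> I"
  by (simp add: scaleR_scaleC closed_ideal_scaleC)

lemma closed_ideal_minus: "x \<in> I \<Longrightarrow> - x \<in> I"
  using closed_ideal_csubspace by (rule complex_vector.subspace_neg)

lemma closed_ideal_diff: "x \<in> I \<Longrightarrow> y \<in> I \<Longrightarrow> x - y \<in> I"
  using closed_ideal_csubspace by (rule complex_vector.subspace_diff)

lemma closed_ideal_sum: "(\<And>i. i \<in> A \<Longrightarrow> f i \<in> I) \<Longrightarrow> sum f A \<in> I"
  using closed_ideal_csubspace by (rule complex_vector.subspace_sum)

lemma closed_ideal_mult_left: "x \<in> I \<Longrightarrow> a * x \<in> I"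
  and closed_ideal_mult_right: "x \<in> I \<Longrightarrow> x * a \<in> I"
  using I by (simp_all add: closed_ideal_def)

end

lemma closed_ideal_UNIV: "closed_ideal UNIV"
  by (simp add: closed_ideal_def complex_vector.subspace_UNIV)

lemma closed_ideal_INT: "(\<And>i. i \<in> A \<Longrightarrow> closed_ideal (f i)) \<Longrightarrow> closed_ideal (\<Inter>i\<in>A. f i)"
  by (auto simp: closed_ideal_def intro!: complex_vector.subspace_Inter closed_INT)

lemma closed_ideal_Int: "closed_ideal I \<Longrightarrow> closed_ideal J \<Longrightarrow> closed_ideal (I \<inter> J)"
  by (auto simp: closed_ideal_def intro: complex_vector.subspace_inter)

text \<open>Stands in for the injectivity of left multiplication by \<open>1 - b\<close> when there
  may be no unit: \<open>norm d \<le> norm b * norm d\<close> forces \<open>d = 0\<close>.\<close>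

lemma fixed_left_mult_eq_0:
  fixes b d :: "'a::cstar_algebra"
  assumes "norm b < 1" "d = b * d"
  shows "d = 0"
proof (rule ccontr)
  assume "d \<noteq> 0"
  have "norm d \<le> norm b * norm d" using assms(2) norm_mult_ineq[of b d] by simp
  also have "\<dots> < 1 * norm d" using \<open>d \<noteq> 0\<close> assms(1) by (intro mult_strict_right_mono) auto
  finally show False by simp
qed

text \<open>\<open>1 + w\<close> is the Cayley transform \<open>(1 + b) (1 - b)\<^sup>-\<^sup>1\<close>, written without the unit,
  and the last equation says that it is unitary.\<close>

lemma cayley_transform:
  fixes b :: "'a::cstar_algebra"
  assumes b: "star b = - b" "norm b < 1"
  obtains w where "w = 2 *\<^sub>R b + b * w" "star w = - 2 *\<^sub>R b - star w * b"
    "w + star w + w * star w = 0"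
proof -
  \<comment> \<open>The fixed point solves \<open>(1 - b) w = 2 b\<close>; the map is a contraction
    with constant \<open>norm b\<close>.\<close>
  have "\<exists>!w. 2 *\<^sub>R b + b * w = w"
    using b by (intro banach_fix_type[of "norm b"])
      (simp_all add: dist_norm norm_mult_ineq flip: right_diff_distrib)
  then obtain w where w: "w = 2 *\<^sub>R b + b * w" by metis
  \<comment> \<open>Inserting the equation for \<open>w\<close> once in each product shows that the
    commutator is fixed by left multiplication by \<open>b\<close>.\<close>
  have "b * w - w * b = b * (b * w - w * b)"
    by (subst (1 2) w) (simp add: algebra_simps)
  then have comm: "b * w = w * b"
    using fixed_left_mult_eq_0[of b "b * w - w * b"] b by simp
  have v: "star w = - 2 *\<^sub>R b - star w * b"
    by (subst w) (simp add: star_add star_mult b scaleR_scaleC star_scaleC)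
  have "star (b * w) = star (w * b)" by (simp add: comm)
  then have comm': "star w * b = b * star w" by (simp add: star_mult b)
  let ?d = "w + star w + w * star w"
  have "b * w = w - 2 *\<^sub>R b" using w by (simp add: algebra_simps)
  moreover have "b * star w = - 2 *\<^sub>R b - star w" using v comm' by (simp add: algebra_simps)
  ultimately have "?d = b * ?d"
    by (simp only: distrib_left mult.assoc[symmetric])
      (simp add: left_diff_distrib scaleR_2 algebra_simps)
  then have "?d = 0" using fixed_left_mult_eq_0[of b ?d] b by simp
  then show ?thesis using that w v by blast
qed

text \<open>No functional calculus is involved: \<open>p\<close> is a mean of the elements
  \<open>1 - (1 + w)^k\<close> for a unitary \<open>1 + w\<close>, and \<open>x - x * p\<close> is
  the corresponding ergodic mean. Membership of \<open>star p\<close> is a separate conclusion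
  because self-adjointness of \<open>K\<close> is deduced from this lemma.\<close>

lemma approximate_unit:
  fixes K :: "'a::cstar_algebra set"
  assumes K: "closed_ideal K" and x: "x \<in> K" and \<epsilon>: "\<epsilon> > 0"
  obtains p where "p \<in> K" "star p \<in> K" "norm (x - x * p) < \<epsilon>"
proof -
  \<comment> \<open>Scaling brings the norm strictly below 1, as the Cayley transform requires; it
    is undone at the end through \<open>\<delta> = c * \<epsilon>\<close>.\<close>
  define c where "c = 1 / (1 + norm x)"
  have c: "c > 0" by (simp add: c_def add_pos_nonneg)
  define x' where "x' = c *\<^sub>R x"
  have x'K: "x' \<in> K" using K x by (simp add: x'_def closed_ideal_scaleR)
  have nx: "norm x' < 1" by (simp add: x'_def c_def divide_less_eq add_pos_nonneg)
  define y where "y = star x' * x'"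
  have yK: "y \<in> K" using K x'K by (simp add: y_def closed_ideal_mult_left)
  have ny: "norm y < 1" using nx by (simp add: y_def cstar_identity abs_square_less_1)
  have sy: "star y = y" by (simp add: y_def star_mult star_star)
  define b where "b = \<i> *\<^sub>C y"
  have bK: "b \<in> K" using K yK by (simp add: b_def closed_ideal_scaleC)
  have b: "star b = - b" "norm b < 1"
    by (simp_all add: b_def star_scaleC sy norm_scaleC ny)
  obtain w where w: "w = 2 *\<^sub>R b + b * w" "star w = - 2 *\<^sub>R b - star w * b"
    "w + star w + w * star w = 0"
    using cayley_transform[OF b] by blast
  have wK: "w \<in> K"
    by (subst w(1)) (simp add: K bK closed_ideal_add closed_ideal_scaleR closed_ideal_mult_right)
  have vK: "star w \<in> K"
    by (subst w(2)) (use K bK in \<open>simp add: closed_ideal_diff closed_ideal_minus closed_ideal_scaleR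
        closed_ideal_mult_left del: scaleR_minus_left\<close>)
  \<comment> \<open>\<open>e k\<close> stands for \<open>(1 + w)\<^sup>k - 1\<close>, so that \<open>a \<mapsto> a + a * e k\<close> is multiplication by a unitary.\<close>
  define e where "e = rec_nat 0 (\<lambda>_ a. a + w + w * a)"
  have e0: "e 0 = 0" and eS: "e (Suc k) = e k + w + w * e k" for k
    by (simp_all add: e_def)
  have isometry: "norm (a + a * e k) = norm a" for a k
  proof (induction k arbitrary: a)
    case (Suc k)
    have "(a + a * w) * star (a + a * w) = a * star a + a * (w + star w + w * star w) * star a"
      by (simp add: star_add star_mult algebra_simps)
    then have "norm (a + a * w) = norm a"
      using cstar_identity'[of "a + a * w"] cstar_identity'[of a] by (simp add: w(3))
    moreover have "a + a * e (Suc k) = (a + a * w) + (a + a * w) * e k"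
      by (simp add: eS algebra_simps)
    ultimately show ?case by (metis Suc)
  qed (simp add: e0)
  have bound: "norm (a * e k) \<le> 2 * norm a" for a k
    using norm_triangle_ineq4[of "a + a * e k" a] isometry[of a k] by simp
  \<comment> \<open>With \<open>a = star (e k)\<close>, the previous bound becomes a quadratic
    inequality for \<open>norm (e k)\<close>.\<close>
  have e_bound: "norm (e k) \<le> 2" for k
    using bound[of "star (e k)" k] cstar_identity[of "e k"]
    by (cases "e k = 0") (simp_all add: power2_eq_square)
  have eK: "e k \<in> K" for k
    by (induction k) (simp_all add: e0 eS K wK closed_ideal_zero closed_ideal_add closed_ideal_mult_right)
  have veK: "star (e k) \<in> K" for k
    by (induction k) (simp_all add: e0 eS star_add star_mult K vK closed_ideal_zero
        closed_ideal_add closed_ideal_mult_left)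
  \<comment> \<open>A mean ergodic argument: \<open>star x' * x'\<close> is a multiple of \<open>w\<close>, so \<open>star x' * X n\<close> telescopes and stays
    bounded, hence \<open>X n / n\<close> tends to zero.\<close>
  define X where "X n = (\<Sum>k<n. x' + x' * e k)" for n
  have X_bound: "(norm (X n))\<^sup>2 \<le> 6 * real n" for n
  proof -
    have tele: "(\<Sum>k<n. w + w * e k) = e n"
      by (induction n) (simp_all add: e0 eS)
    \<comment> \<open>Since \<open>2 b = (1 - b) w\<close>, twice the sum of the terms
      \<open>b (1 + w)^k\<close> is \<open>1 - b\<close> times the telescoping sum
      \<open>e n\<close>.\<close>
    have b_w: "2 *\<^sub>R b = w - b * w" using w(1) by (simp add: algebra_simps)
    have "2 *\<^sub>R (\<Sum>k<n. b + b * e k) = (\<Sum>k<n. 2 *\<^sub>R b + (2 *\<^sub>R b) * e k)"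
      by (simp add: scaleR_right.sum scaleR_add_right)
    also have "\<dots> = (\<Sum>k<n. w + w * e k) - b * (\<Sum>k<n. w + w * e k)"
      unfolding b_w by (simp add: sum_distrib_left algebra_simps sum.distrib sum_subtractf)
    also have "\<dots> = e n - b * e n" by (simp only: tele)
    finally have "2 * norm (\<Sum>k<n. b + b * e k) = norm (e n - b * e n)"
      by (metis norm_scaleR abs_numeral)
    also have "\<dots> \<le> 4"
      using norm_triangle_ineq4[of "e n" "b * e n"] e_bound[of n] bound[of b n] b(2) by linarith
    finally have nb: "norm (\<Sum>k<n. b + b * e k) \<le> 2" by simp
    have "(\<Sum>k<n. b + b * e k) = \<i> *\<^sub>C (star x' * X n)"
      by (simp add: X_def b_def y_def mult_scaleC_left complex_vector.scale_sum_right
          sum_distrib_left scaleC_add_right algebra_simps)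
    then have nY: "norm (star x' * X n) \<le> 2" using nb by (simp add: norm_scaleC)
    have sX: "star (X n) = (\<Sum>k<n. star x' + star (e k) * star x')"
      by (simp add: X_def star_sum star_add star_mult)
    \<comment> \<open>Only the left factor is expanded. Each of the \<open>n\<close> terms has norm
      at most \<open>2 + 2 * 2\<close>, so the squared norm of \<open>X n\<close> grows linearly and
      not quadratically.\<close>
    have "star (X n) * X n = (\<Sum>k<n. star x' * X n + star (e k) * (star x' * X n))"
      by (simp only: sX sum_distrib_right distrib_right mult.assoc)
    then have "(norm (X n))\<^sup>2 = norm (\<Sum>k<n. star x' * X n + star (e k) * (star x' * X n))"
      by (metis cstar_identity)
    also have "\<dots> \<le> (\<Sum>k<n. 6)"
    proof (rule sum_norm_le)
      fix k
      have "norm (star (e k) * (star x' * X n)) \<le> 2 * 2"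
        using e_bound[of k] nY norm_mult_ineq[of "star (e k)" "star x' * X n"]
          mult_mono[of "norm (star (e k))" 2 "norm (star x' * X n)" 2] by simp
      then show "norm (star x' * X n + star (e k) * (star x' * X n)) \<le> 6"
        using norm_triangle_ineq[of "star x' * X n" "star (e k) * (star x' * X n)"] nY by linarith
    qed
    finally show ?thesis by (simp add: mult.commute)
  qed
  define \<delta> where "\<delta> = c * \<epsilon>"
  have \<delta>: "\<delta> > 0" using c \<epsilon> by (simp add: \<delta>_def)
  \<comment> \<open>The mean \<open>X n / n\<close> has squared norm at most \<open>6 / n\<close>,
    which this choice makes smaller than \<open>\<delta>^2\<close>.\<close>
  obtain n where n: "real n > 6 / \<delta>\<^sup>2" using reals_Archimedean2 by blast
  then have n0: "real n > 0" using \<delta> by (smt (verit) divide_pos_pos zero_less_power)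
  define p where "p = - (1 / real n) *\<^sub>R (\<Sum>k<n. e k)"
  have "x' - x' * p = (1 / real n) *\<^sub>R X n"
    using n0 by (simp add: p_def X_def sum.distrib sum_distrib_left scaleR_add_right
        sum_constant_scaleR)
  then have "real n * norm (x' - x' * p) = norm (X n)" using n0 by simp
  then have "(real n * norm (x' - x' * p))\<^sup>2 \<le> 6 * real n" using X_bound[of n] by simp
  then have "real n * (norm (x' - x' * p))\<^sup>2 \<le> 6"
    using n0 by (simp add: power2_eq_square ac_simps)
  also have "6 < real n * \<delta>\<^sup>2" using n \<delta> by (simp add: field_simps)
  finally have "norm (x' - x' * p) < \<delta>"
    using n0 \<delta> by (simp add: power_less_imp_less_base)
  moreover have "x' - x' * p = c *\<^sub>R (x - x * p)"
    by (simp add: x'_def scaleR_diff_right)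
  ultimately have "norm (x - x * p) < \<epsilon>" using c by (simp add: \<delta>_def)
  moreover have "p \<in> K" unfolding p_def
    using K eK by (intro closed_ideal_scaleR closed_ideal_sum) auto
  moreover have "star p = (- (1 / real n)) *\<^sub>R (\<Sum>k<n. star (e k))"
    by (simp add: p_def star_minus star_sum scaleR_scaleC star_scaleC)
  then have "star p \<in> K"
    using K veK by (simp only:) (intro closed_ideal_scaleR closed_ideal_sum, auto)
  ultimately show ?thesis using that by blast
qed

text \<open>The products \<open>star p * star x\<close> approximate \<open>star x\<close> and lie in
  \<open>K\<close>, because \<open>star p\<close> does and \<open>K\<close> is two-sided.\<close>

lemma closed_ideal_star:
  assumes K: "closed_ideal K" and x: "x \<in> K"
  shows "star x \<in> K"
proof -
  have "\<exists>y\<in>K. dist y (star x) < \<epsilon>" if "\<epsilon> > 0" for \<epsilon>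
  proof -
    obtain p where p: "p \<in> K" "star p \<in> K" "norm (x - x * p) < \<epsilon>"
      using approximate_unit[OF K x \<open>\<epsilon> > 0\<close>] by blast
    have "norm (star (x - x * p)) < \<epsilon>" using p by simp
    then have "dist (star p * star x) (star x) < \<epsilon>"
      by (simp only: star_diff star_mult dist_norm norm_minus_commute)
    then show ?thesis using closed_ideal_mult_right[OF K p(2)] by blast
  qed
  then show ?thesis
    using closed_ideal_closed[OF K] by (metis closure_approachable closure_closed)
qed

text \<open>The inclusion from right to left uses an approximate unit of the intersection:
  \<open>x\<close> is a limit of products \<open>x * p\<close>, whose first factor lies in
  \<open>I\<close> and second in \<open>J\<close>.\<close>

lemma ideal_product_eq_Int:
  assumes I: "closed_ideal I" and J: "closed_ideal J"
  shows "ideal_product I J = I \<inter> J"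
proof
  have K: "closed_ideal (I \<inter> J)" using I J by (rule closed_ideal_Int)
  have "{x * y |x y. x \<in> I \<and> y \<in> J} \<subseteq> I \<inter> J"
    using I J by (auto simp: closed_ideal_mult_left closed_ideal_mult_right)
  then have "cspan {x * y |x y. x \<in> I \<and> y \<in> J} \<subseteq> I \<inter> J"
    using closed_ideal_csubspace[OF K] by (rule complex_vector.span_minimal)
  then show "ideal_product I J \<subseteq> I \<inter> J"
    unfolding ideal_product_def using closed_ideal_closed[OF K] by (rule closure_minimal)
  show "I \<inter> J \<subseteq> ideal_product I J"
  proof
    fix x assume x: "x \<in> I \<inter> J"
    have "\<exists>z\<in>cspan {x * y |x y. x \<in> I \<and> y \<in> J}. dist z x < \<epsilon>" if "\<epsilon> > 0" for \<epsilon>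
    proof -
      obtain p where p: "p \<in> I \<inter> J" "norm (x - x * p) < \<epsilon>"
        using approximate_unit[OF K x \<open>\<epsilon> > 0\<close>] by blast
      have "x * p \<in> cspan {x * y |x y. x \<in> I \<and> y \<in> J}"
        using x p by (intro complex_vector.span_base) blast
      then show ?thesis using p(2) by (intro bexI[of _ "x * p"]) (simp_all add: dist_norm norm_minus_commute)
    qed
    then show "x \<in> ideal_product I J"
      by (simp add: ideal_product_def closure_approachable)
  qed
qed

lemma ideal_products_eq_Inter:
  "(\<And>I. I \<in> set Is \<Longrightarrow> closed_ideal I) \<Longrightarrow> ideal_products Is = \<Inter> (set Is)"
proof (induction Is rule: ideal_products.induct)
  case (3 I J Js)
  have "closed_ideal (\<Inter> (set (J # Js)))"
    using closed_ideal_INT[of "set (J # Js)" id] 3 by simp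
  then show ?case using 3 by (simp add: ideal_product_eq_Int)
qed simp_all

section \<open>Partial isometries and their adjoints\<close>

lemma cinner_add_right: "cinner x (y + z) = cinner x y + cinner x (z::'h::complex_hilbert)"
  by (metis cinner_add_left cinner_commute complex_cnj_add)

lemma cinner_scaleC_right: "cinner x (c *\<^sub>C y) = cnj c * cinner x (y::'h::complex_hilbert)"
  by (metis cinner_commute cinner_scaleC_left complex_cnj_mult)

lemma cinner_zero_left [simp]: "cinner 0 x = 0"
  using cinner_add_left[of 0 0 x] by simp

lemma cinner_zero_right [simp]: "cinner x 0 = 0"
  using cinner_add_right[of x 0 0] by simp

lemma cinner_minus_left: "cinner (- x) y = - cinner x y"
  using cinner_add_left[of "- x" x y] by (simp add: eq_neg_iff_add_eq_0)

lemma cinner_minus_right: "cinner x (- y) = - cinner x y"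
  using cinner_add_right[of x "- y" y] by (simp add: eq_neg_iff_add_eq_0)

lemma cinner_diff_left: "cinner (x - y) z = cinner x z - cinner y z"
  using cinner_add_left[of x "- y" z] by (simp add: cinner_minus_left)

lemma cinner_diff_right: "cinner x (y - z) = cinner x y - cinner x z"
  using cinner_add_right[of x y "- z"] by (simp add: cinner_minus_right)

lemma cinner_self_eq_0_iff: "cinner x x = 0 \<longleftrightarrow> x = 0"
  by (simp add: cinner_self)

lemma cinner_eqI: "(\<And>z. cinner x z = cinner y z) \<Longrightarrow> x = y"
  using cinner_self_eq_0_iff[of "x - y"] by (simp add: cinner_diff_left)

lemma cinner_eq_0_commute: "cinner x y = 0 \<longleftrightarrow> cinner y x = 0"
  by (metis cinner_commute complex_cnj_zero)

lemma is_adjointD: "is_adjoint S T \<Longrightarrow> cinner (T x) y = cinner x (S y)"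
  by (simp add: is_adjoint_def)

lemma is_adjoint_sym: "is_adjoint S T \<Longrightarrow> is_adjoint T S"
  unfolding is_adjoint_def by (metis cinner_commute)

lemma is_adjoint_comp: "is_adjoint S T \<Longrightarrow> is_adjoint P R \<Longrightarrow> is_adjoint (P \<circ> S) (T \<circ> R)"
  by (simp add: is_adjoint_def)

lemma bounded_clinear_comp: "bounded_clinear S \<Longrightarrow> bounded_clinear T \<Longrightarrow> bounded_clinear (S \<circ> T)"
  by (simp add: bounded_clinear_def bounded_linear_compose o_def)

lemma bounded_clinear_id: "bounded_clinear id"
  by (simp add: bounded_clinear_def id_def)

lemma bounded_clinear_diff: "bounded_clinear T \<Longrightarrow> T (x - y) = T x - T y"
  by (simp add: bounded_clinear_def bounded_linear.linear linear_diff)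

lemma csubspace_orthogonal_complement: "csubspace (orthogonal_complement X)"
  by (rule complex_vector.subspaceI)
    (auto simp: orthogonal_complement_def cinner_add_right cinner_scaleC_right)

lemma norm_cinner_self: "norm x = sqrt (Re (cinner x x))"
  by (simp add: cinner_self)

lemma pythagoras:
  assumes "cinner x y = 0"
  shows "(norm (x + y))\<^sup>2 = (norm x)\<^sup>2 + (norm (y::'h::complex_hilbert))\<^sup>2"
proof -
  have "cinner (x + y) (x + y) = cinner x x + cinner y y"
    using assms cinner_eq_0_commute[of x y] by (simp add: cinner_add_left cinner_add_right)
  then show ?thesis by (simp add: cinner_self flip: of_real_add of_real_power)
qed

lemma cinner_Cauchy_Schwarz: "cmod (cinner x y) \<le> norm x * norm (y::'h::complex_hilbert)"
proof (cases "y = 0")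
  case False
  define c where "c = cinner x y / cinner y y"
  have yy: "cinner y y \<noteq> 0" using False by (simp add: cinner_self)
  have "cinner (x - c *\<^sub>C y) (c *\<^sub>C y) = 0"
    using yy by (simp add: cinner_diff_left cinner_scaleC_left cinner_scaleC_right c_def)
  from pythagoras[OF this] have "(norm (c *\<^sub>C y))\<^sup>2 \<le> (norm x)\<^sup>2" by simp
  then have "cmod c * norm y \<le> norm x" by (simp add: norm_scaleC power_mono_iff)
  moreover have "cmod c = cmod (cinner x y) / (norm y)\<^sup>2"
    by (simp add: c_def norm_divide cinner_self norm_power)
  ultimately show ?thesis using False by (simp add: field_simps power2_eq_square)
qed simp

lemma closed_orthogonal_complement: "closed (orthogonal_complement (X::'h::complex_hilbert set))"
proof -
  have "bounded_linear (\<lambda>y. cinner x y)" for x :: 'h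
    by (rule bounded_linear_intro[of _ "norm x"])
      (simp_all add: cinner_add_right cinner_scaleC_right scaleR_scaleC[where 'a='h]
        scaleR_conv_of_real cinner_Cauchy_Schwarz mult.commute[of "norm _" "norm x"])
  then have "closed {y. cinner x y = 0}" for x :: 'h
    by (intro closed_Collect_eq continuous_intros linear_continuous_on)
  moreover have "orthogonal_complement X = (\<Inter>x\<in>X. {y. cinner x y = 0})"
    by (auto simp: orthogonal_complement_def)
  ultimately show ?thesis by auto
qed

text \<open>An equational form of "\<open>T\<close> is a partial isometry with adjoint
  \<open>S\<close>". It is symmetric in \<open>T\<close> and \<open>S\<close>, and easier to compose
  than conditions on initial and final spaces.\<close>

definition adjoint_partial_isometries :: "('h::complex_hilbert \<Rightarrow> 'h) \<Rightarrow> ('h \<Rightarrow> 'h) \<Rightarrow> bool" where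
  "adjoint_partial_isometries T S \<longleftrightarrow> bounded_clinear T \<and> bounded_clinear S \<and> is_adjoint S T \<and>
     (\<forall>h. T (S (T h)) = T h) \<and> (\<forall>h. S (T (S h)) = S h)"

lemma adjoint_partial_isometries_sym:
  "adjoint_partial_isometries T S \<Longrightarrow> adjoint_partial_isometries S T"
  by (auto simp: adjoint_partial_isometries_def is_adjoint_sym)

lemma adjoint_partial_isometries_id: "adjoint_partial_isometries id id"
  by (simp add: adjoint_partial_isometries_def is_adjoint_def bounded_clinear_id)

context
  fixes T S :: "'h::complex_hilbert \<Rightarrow> 'h"
  assumes TS: "adjoint_partial_isometries T S"
begin

lemma adjoint_TST: "T (S (T h)) = T h" and adjoint_STS: "S (T (S h)) = S h"
  and adjoint_cinner: "cinner (T x) y = cinner x (S y)"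
  using TS by (simp_all add: adjoint_partial_isometries_def is_adjoint_def)

text \<open>The vector \<open>h - S (T h)\<close> lies in the kernel of \<open>T\<close>. It is
  orthogonal to \<open>h\<close> by the choice of \<open>h\<close> and to \<open>S (T h)\<close> by
  adjointness, hence to itself.\<close>

lemma adjoint_initial_space: "initial_space T = range S"
proof (intro equalityI subsetI)
  fix h assume "h \<in> initial_space T"
  then have orth: "cinner k h = 0" if "T k = 0" for k
    using that by (simp add: initial_space_def orthogonal_complement_def)
  let ?k = "h - S (T h)"
  have "T ?k = 0"
    using TS by (simp add: adjoint_partial_isometries_def bounded_clinear_diff)
  then have "cinner ?k h = 0" "cinner ?k (S (T h)) = 0"
    using orth by (simp_all flip: adjoint_cinner)
  then have "?k = 0" by (metis cinner_diff_right cinner_self_eq_0_iff diff_zero)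
  then show "h \<in> range S" by (metis eq_iff_diff_eq_0 rangeI)
qed (auto simp: initial_space_def orthogonal_complement_def simp flip: adjoint_cinner)

lemma adjoint_norm_on_initial: "norm (T (S y)) = norm (S y)"
  by (simp add: norm_cinner_self[of "T (S y)"] norm_cinner_self[of "S y"] adjoint_cinner adjoint_STS)

lemma adjoint_partial_isometry: "partial_isometry T"
  using TS by (auto simp: partial_isometry_def adjoint_initial_space adjoint_norm_on_initial
      adjoint_partial_isometries_def)

text \<open>\<open>S T\<close> is an orthogonal projection, hence contractive by Pythagoras, and
  \<open>T\<close> is isometric on its range.\<close>

lemma adjoint_norm_le: "norm (T h) \<le> norm h"
proof -
  have "cinner (S (T h)) (h - S (T h)) = 0"
    using adjoint_cinner[of "h - S (T h)" "T h"] TS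
    by (simp add: bounded_clinear_diff adjoint_TST adjoint_partial_isometries_def cinner_eq_0_commute)
  from pythagoras[OF this] have "(norm (S (T h)))\<^sup>2 \<le> (norm h)\<^sup>2" by simp
  then have "norm (S (T h)) \<le> norm h" by (simp add: power_mono_iff)
  then show ?thesis using adjoint_norm_on_initial[of "T h"] by (simp add: adjoint_TST)
qed

end

text \<open>Both operators are isometric on each other's range. Expanding the squared norm of
  \<open>Q (P (Q h)) - Q h\<close> therefore gives four inner products, all equal to that of
  \<open>Q h\<close> with itself, which cancel.\<close>

lemma partial_isometry_adjoint:
  assumes "partial_isometry T" "partial_isometry S" and adj: "is_adjoint S T"
    and T: "initial_space T = range S" and S: "initial_space S = range T"
  shows "adjoint_partial_isometries T S"
proof -
  have main: "Q (P (Q h)) = Q h"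
    if "partial_isometry P" "partial_isometry Q" "is_adjoint Q P"
      "initial_space P = range Q" "initial_space Q = range P" for P Q :: "'a \<Rightarrow> 'a" and h
  proof -
    have n1: "norm (P (Q h)) = norm (Q h)" and n2: "norm (Q (P (Q h))) = norm (Q h)"
      using that by (auto simp: partial_isometry_def)
    have "cinner (Q (P (Q h))) (Q h) = cinner (P (Q h)) (P (Q h))"
      using that(3) by (simp add: is_adjointD[OF is_adjoint_sym])
    also have "\<dots> = cinner (Q h) (Q h)" using n1 by (simp add: cinner_self)
    finally have 1: "cinner (Q (P (Q h))) (Q h) = cinner (Q h) (Q h)" .
    then have 2: "cinner (Q h) (Q (P (Q h))) = cinner (Q h) (Q h)"
      by (metis cinner_commute)
    have "cinner (Q (P (Q h))) (Q (P (Q h))) = cinner (Q h) (Q h)" using n2 by (simp add: cinner_self)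
    with 1 2 have "cinner (Q (P (Q h)) - Q h) (Q (P (Q h)) - Q h) = 0"
      by (simp add: cinner_diff_left cinner_diff_right)
    then show ?thesis by (simp add: cinner_self_eq_0_iff)
  qed
  show ?thesis
    using assms main[of T S] main[of S T] is_adjoint_sym[OF adj]
    by (auto simp: adjoint_partial_isometries_def partial_isometry_def)
qed

text \<open>The initial projection \<open>S T\<close> of the left factor commutes with the final
  projection \<open>R P\<close> of the right one, so
  \<open>T R P S T R = T S T R P R = T R\<close>.\<close>

lemma adjoint_partial_isometries_comp:
  assumes TS: "adjoint_partial_isometries T S" and RP: "adjoint_partial_isometries R P"
    and comm: "\<And>h. S (T (R (P h))) = R (P (S (T h)))"
  shows "adjoint_partial_isometries (T \<circ> R) (P \<circ> S)"
proof -
  note simps = adjoint_TST[OF TS] adjoint_STS[OF TS] adjoint_TST[OF RP] adjoint_STS[OF RP]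
  have "T (R (P (S (T (R h))))) = T (R h)" for h
    by (metis comm simps)
  moreover have "P (S (T (R (P (S h))))) = P (S h)" for h
    by (metis comm simps)
  ultimately show ?thesis
    using TS RP by (auto simp: adjoint_partial_isometries_def bounded_clinear_comp
        intro: is_adjoint_comp)
qed

text \<open>For the projections \<open>A = S T\<close> and \<open>B = R P\<close>, invariance says
  \<open>B A B = A B\<close>; the left side is self-adjoint, so taking adjoints gives
  \<open>A B = B A\<close>.\<close>

lemma adjoint_projections_commute:
  assumes TS: "adjoint_partial_isometries T S" and RP: "adjoint_partial_isometries R P"
    and invariant: "\<And>h. S (T (R h)) \<in> range R"
  shows "S (T (R (P h))) = R (P (S (T h)))"
proof (rule cinner_eqI)
  fix m
  note T = adjoint_cinner[OF TS] adjoint_cinner[OF adjoint_partial_isometries_sym[OF TS]]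
  note R = adjoint_cinner[OF RP] adjoint_cinner[OF adjoint_partial_isometries_sym[OF RP]]
  have fixed: "R (P (S (T (R (P k))))) = S (T (R (P k)))" for k
    using invariant[of "P k"] adjoint_TST[OF RP] by (metis rangeE)
  have "cinner (R (P (S (T h)))) m = cinner h (S (T (R (P m))))" by (simp add: T R)
  also have "\<dots> = cinner h (R (P (S (T (R (P m))))))" by (simp only: fixed)
  also have "\<dots> = cinner (R (P (S (T (R (P h)))))) m" by (simp add: T R)
  finally show "cinner (S (T (R (P h)))) m = cinner (R (P (S (T h)))) m" by (simp only: fixed)
qed

text \<open>An idempotent contraction is an orthogonal projection, so a generalized inverse of a
  partial isometry that is itself a contraction has to be the adjoint.\<close>

lemma adjoint_unique_inverse:
  assumes TS: "adjoint_partial_isometries T S" and TS': "adjoint_partial_isometries T' S'"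
    and TT'T: "\<And>h. T (T' (T h)) = T h" and T'TT': "\<And>h. T' (T (T' h)) = T' h"
  shows "T' = S"
proof -
  \<comment> \<open>The error \<open>Q (P (P' y)) - P' y\<close> is killed by \<open>P\<close>,
    hence orthogonal to \<open>P' y\<close>. Since \<open>Q\<close> and \<open>P\<close> are
    contractions, Pythagoras leaves no room for it.\<close>
  have fixed: "Q (P (P' y)) = P' y"
    if PP': "adjoint_partial_isometries P P'" and Q: "adjoint_partial_isometries Q Q'"
      and PQP: "\<And>h. P (Q (P h)) = P h" for P P' Q Q' :: "'a \<Rightarrow> 'a" and y
  proof -
    let ?k = "Q (P (P' y)) - P' y"
    have "P ?k = 0"
      using PP' PQP by (simp add: adjoint_partial_isometries_def bounded_clinear_diff)
    then have "cinner (P' y) ?k = 0"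
      using adjoint_cinner[OF PP', of ?k y] by (simp add: cinner_eq_0_commute)
    from pythagoras[OF this]
    have "(norm (Q (P (P' y))))\<^sup>2 = (norm (P' y))\<^sup>2 + (norm ?k)\<^sup>2" by simp
    moreover have "norm (Q (P (P' y))) \<le> norm (P' y)"
      using adjoint_norm_le[OF Q, of "P (P' y)"] adjoint_norm_le[OF PP', of "P' y"] by simp
    then have "(norm (Q (P (P' y))))\<^sup>2 \<le> (norm (P' y))\<^sup>2" by (simp add: power_mono)
    ultimately have "(norm ?k)\<^sup>2 \<le> 0" by linarith
    then show ?thesis by simp
  qed
  have a: "T' (T h) = S (T h)" for h
    using fixed[OF TS TS' TT'T, of "T h"] by (simp add: adjoint_TST[OF TS])
  have b: "T (T' h) = S' (T' h)" for h
    using fixed[OF TS' TS T'TT', of "T' h"] by (simp add: adjoint_TST[OF TS'])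
  \<comment> \<open>By \<open>b\<close>, \<open>T T'\<close> is the self-adjoint projection
    \<open>S' T'\<close>, and it has the same range as \<open>T S\<close>; two such projections
    coincide.\<close>
  have "T (T' h) = T (S h)" for h
  proof (rule cinner_eqI)
    fix m
    have "cinner (T (S h)) m = cinner h (T (S m))"
      using adjoint_cinner[OF TS] adjoint_cinner[OF adjoint_partial_isometries_sym[OF TS]] by simp
    also have "\<dots> = cinner h (S' (T' (T (S m))))" by (simp add: TT'T flip: b)
    also have "\<dots> = cinner (T (T' h)) (T (S m))"
      using adjoint_cinner[OF TS'] adjoint_cinner[OF adjoint_partial_isometries_sym[OF TS']]
      by (simp add: b)
    also have "\<dots> = cinner (T (S (T (T' h)))) m"
      using adjoint_cinner[OF TS] adjoint_cinner[OF adjoint_partial_isometries_sym[OF TS]] by simp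
    finally show "cinner (T (T' h)) m = cinner (T (S h)) m" by (simp add: adjoint_TST[OF TS])
  qed
  \<comment> \<open>The chain is \<open>T' = T' T T' = S T T' = S T S = S\<close>.\<close>
  then have "T' h = S h" for h
    by (metis a T'TT' adjoint_STS[OF TS])
  then show ?thesis by blast
qed

section \<open>Words in a partial action\<close>

context unital_inverse_semigroup
begin

lemma
  assumes "s \<in> carrier G"
  shows star_closed: "s\<^sup>\<star> \<in> carrier G"
    and mult_star_mult: "s \<otimes> s\<^sup>\<star> \<otimes> s = s"
    and star_mult_star: "s\<^sup>\<star> \<otimes> s \<otimes> s\<^sup>\<star> = s\<^sup>\<star>"
  using theI'[OF unique_inverse[OF assms]] by (simp_all add: semigroup_inverse_def)

lemma star_eqI:
  assumes "s \<in> carrier G" "t \<in> carrier G" "s \<otimes> t \<otimes> s = s" "t \<otimes> s \<otimes> t = t"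
  shows "s\<^sup>\<star> = t"
  unfolding semigroup_inverse_def using assms by (intro the1_equality unique_inverse) auto

lemma star_star_eq: "s \<in> carrier G \<Longrightarrow> (s\<^sup>\<star>)\<^sup>\<star> = s"
  by (intro star_eqI) (simp_all add: star_closed mult_star_mult star_mult_star)

lemma star_one: "\<one>\<^sup>\<star> = \<one>"
  by (intro star_eqI) simp_all

definition word_star :: "'a list \<Rightarrow> 'a list" where
  "word_star gs = rev (map (semigroup_inverse G) gs)"

lemma word_star_closed: "set gs \<subseteq> carrier G \<Longrightarrow> set (word_star gs) \<subseteq> carrier G"
  by (auto simp: word_star_def star_closed)

lemma word_star_word_star: "set gs \<subseteq> carrier G \<Longrightarrow> word_star (word_star gs) = gs"
  by (induction gs) (simp_all add: word_star_def star_star_eq)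

lemma word_product_closed: "set gs \<subseteq> carrier G \<Longrightarrow> foldr (\<otimes>) gs \<one> \<in> carrier G"
  by (induction gs) simp_all

end

text \<open>The coordinates of \<open>word_element\<close> get separate names, since the maps and
  the operators are treated by separate inductions, both starting from the empty word.\<close>

definition word_map :: "('g \<Rightarrow> 'a \<rightharpoonup> 'a) \<Rightarrow> 'g list \<Rightarrow> 'a \<rightharpoonup> 'a" where
  "word_map \<alpha> gs = foldr (\<lambda>g f. \<alpha> g \<circ>\<^sub>m f) gs Some"

definition word_op :: "('g \<Rightarrow> 'h \<Rightarrow> 'h) \<Rightarrow> 'g list \<Rightarrow> 'h \<Rightarrow> 'h" where
  "word_op u gs = foldr (\<lambda>g T. u g \<circ> T) gs id"

lemma word_element_eq: "word_element \<alpha> u gs = (word_map \<alpha> gs, word_op u gs)"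
  by (simp add: word_element_def word_map_def word_op_def)

lemma map_comp_assoc: "(f \<circ>\<^sub>m g) \<circ>\<^sub>m h = f \<circ>\<^sub>m (g \<circ>\<^sub>m h)"
  by (auto simp: map_comp_def fun_eq_iff split: option.splits)

lemma map_comp_Some [simp]: "f \<circ>\<^sub>m Some = f" "Some \<circ>\<^sub>m f = f"
  by (auto simp: map_comp_def fun_eq_iff split: option.splits)

lemma word_map_simps [simp]:
  "word_map \<alpha> [] = Some" "word_map \<alpha> (g # gs) = \<alpha> g \<circ>\<^sub>m word_map \<alpha> gs"
  by (simp_all add: word_map_def)

lemma word_op_simps [simp]: "word_op u [] = id" "word_op u (g # gs) = u g \<circ> word_op u gs"
  by (simp_all add: word_op_def)

lemma word_map_append: "word_map \<alpha> (gs @ hs) = word_map \<alpha> gs \<circ>\<^sub>m word_map \<alpha> hs"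
  by (induction gs) (simp_all add: map_comp_assoc)

lemma word_op_append: "word_op u (gs @ hs) = word_op u gs \<circ> word_op u hs"
  by (induction gs) (simp_all add: comp_assoc)

text \<open>The form with \<open>Some\<close> turns compositions of partial maps into chains of
  equations. Closure of the domain under the involution comes from
  \<open>closed_ideal_star\<close>.\<close>

lemma star_isomorphism_on_iff:
  assumes "closed_ideal I"
  shows "star_isomorphism_on I J f \<longleftrightarrow> dom f = I \<and> ran f = J \<and>
    (\<forall>x y z. f x = Some z \<longrightarrow> f y = Some z \<longrightarrow> x = y) \<and>
    (\<forall>x y a b. f x = Some a \<longrightarrow> f y = Some b \<longrightarrow> f (x + y) = Some (a + b) \<and> f (x * y) = Some (a * b)) \<and>
    (\<forall>x a c. f x = Some a \<longrightarrow> f (c *\<^sub>C x) = Some (c *\<^sub>C a) \<and> f (star x) = Some (star a))"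
proof (cases "dom f = I")
  case True
  then have some: "f x = Some a \<longleftrightarrow> x \<in> I \<and> the (f x) = a" for x a by auto
  have mem: "x + y \<in> I" "x * y \<in> I" "c *\<^sub>C x \<in> I" "star x \<in> I" if "x \<in> I" "y \<in> I" for x y c
    using assms that
    by (simp_all add: closed_ideal_add closed_ideal_mult_left closed_ideal_scaleC closed_ideal_star)
  have ran: "ran f = (\<lambda>x. the (f x)) ` I" by (auto simp: ran_def some)
  have inj: "(\<forall>x y z. f x = Some z \<longrightarrow> f y = Some z \<longrightarrow> x = y) \<longleftrightarrow> inj_on (\<lambda>x. the (f x)) I"
    by (simp add: some inj_on_def) metis
  have ring: "(\<forall>x y a b. f x = Some a \<longrightarrow> f y = Some b \<longrightarrow> f (x + y) = Some (a + b) \<and> f (x * y) = Some (a * b))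
    \<longleftrightarrow> (\<forall>x\<in>I. \<forall>y\<in>I. the (f (x + y)) = the (f x) + the (f y)) \<and>
      (\<forall>x\<in>I. \<forall>y\<in>I. the (f (x * y)) = the (f x) * the (f y))"
    using mem(1,2) by (simp add: some) metis
  have star: "(\<forall>x a c. f x = Some a \<longrightarrow> f (c *\<^sub>C x) = Some (c *\<^sub>C a) \<and> f (star x) = Some (star a))
    \<longleftrightarrow> (\<forall>c. \<forall>x\<in>I. the (f (c *\<^sub>C x)) = c *\<^sub>C the (f x)) \<and>
      (\<forall>x\<in>I. the (f (star x)) = star (the (f x)))"
    using mem(3,4) by (simp add: some) metis
  show ?thesis
    unfolding star_isomorphism_on_def bij_betw_def ran inj ring star
    by (rule iffI; elim conjE; intro conjI; assumption)
qed (simp add: star_isomorphism_on_def)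

lemma star_isomorphism_onD:
  assumes "star_isomorphism_on I J f" "closed_ideal I"
  shows "f x = Some a \<Longrightarrow> f y = Some a \<Longrightarrow> x = y"
    and "f x = Some a \<Longrightarrow> f y = Some b \<Longrightarrow> f (x + y) = Some (a + b)"
    and "f x = Some a \<Longrightarrow> f y = Some b \<Longrightarrow> f (x * y) = Some (a * b)"
    and "f x = Some a \<Longrightarrow> f (c *\<^sub>C x) = Some (c *\<^sub>C a)"
    and "f x = Some a \<Longrightarrow> f (star x) = Some (star a)"
  using assms(1) unfolding star_isomorphism_on_iff[OF assms(2)] by simp_all

text \<open>All properties pass through the intermediate value of \<open>g\<close>. That the
  composite has a closed ideal as domain is a hypothesis; for words it is supplied by
  \<open>dom_word_map\<close>.\<close>

lemma star_isomorphism_on_comp: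
  assumes f: "star_isomorphism_on I J f" "closed_ideal I"
    and g: "star_isomorphism_on I' J' g" "closed_ideal I'"
    and dom: "closed_ideal (dom (f \<circ>\<^sub>m g))"
  shows "star_isomorphism_on (dom (f \<circ>\<^sub>m g)) (ran (f \<circ>\<^sub>m g)) (f \<circ>\<^sub>m g)"
proof -
  note hom = star_isomorphism_onD(2-5)[OF f] star_isomorphism_onD(2-5)[OF g]
  have inj: "x = y" if xy: "(f \<circ>\<^sub>m g) x = Some z" "(f \<circ>\<^sub>m g) y = Some z" for x y z
  proof -
    obtain x' y' where x': "g x = Some x'" "f x' = Some z" and y': "g y = Some y'" "f y' = Some z"
      using xy unfolding map_comp_Some_iff by auto
    have "x' = y'" using star_isomorphism_onD(1)[OF f x'(2) y'(2)] .
    then show ?thesis using star_isomorphism_onD(1)[OF g x'(1)] y'(1) by simp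
  qed
  have ring: "(f \<circ>\<^sub>m g) (x + y) = Some (a + b) \<and> (f \<circ>\<^sub>m g) (x * y) = Some (a * b)"
    if xy: "(f \<circ>\<^sub>m g) x = Some a" "(f \<circ>\<^sub>m g) y = Some b" for x y a b
  proof -
    obtain x' y' where "g x = Some x'" "f x' = Some a" "g y = Some y'" "f y' = Some b"
      using xy unfolding map_comp_Some_iff by auto
    then show ?thesis by (simp add: hom)
  qed
  have star: "(f \<circ>\<^sub>m g) (c *\<^sub>C x) = Some (c *\<^sub>C a) \<and> (f \<circ>\<^sub>m g) (star x) = Some (star a)"
    if x: "(f \<circ>\<^sub>m g) x = Some a" for x a c
  proof -
    obtain x' where "g x = Some x'" "f x' = Some a"
      using x unfolding map_comp_Some_iff by auto
    then show ?thesis by (simp add: hom)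
  qed
  show ?thesis
    unfolding star_isomorphism_on_iff[OF dom]
    by (intro conjI[OF refl] conjI[OF _ conjI] allI impI; rule inj ring star; assumption)
qed

section \<open>Domains and ranges of the partial maps given by words\<close>

context partial_action
begin

lemma dom_\<alpha>: "g \<in> carrier G \<Longrightarrow> dom (\<alpha> g) = D (g\<^sup>\<star>)"
  using star_isomorphism[of g] by (simp add: star_isomorphism_on_def)

lemma \<alpha>_inverse: "g \<in> carrier G \<Longrightarrow> \<alpha> g x = Some y \<longleftrightarrow> \<alpha> (g\<^sup>\<star>) y = Some x"
  using inverse[of g] by (auto simp: Map.graph_def)

lemma ran_\<alpha>: "g \<in> carrier G \<Longrightarrow> ran (\<alpha> g) = D g"
  using dom_\<alpha>[of "g\<^sup>\<star>"] \<alpha>_inverse[of g] by (auto simp: ran_def dom_def star_closed star_star_eq)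

text \<open>\<open>\<alpha> \<one>\<close> is idempotent by \<open>comp\<close>, and injective
  because it is its own inverse; its domain is the whole algebra.\<close>

lemma \<alpha>_one: "\<alpha> \<one> = Some"
proof
  fix x
  obtain y where y: "\<alpha> \<one> x = Some y"
    using dom_\<alpha>[of \<one>] by (auto simp: star_one D_one)
  have "\<alpha> \<one> y = Some y"
    using comp[of \<one> \<one> x] y by (simp add: star_one D_one)
  then show "\<alpha> \<one> x = Some x" using y \<alpha>_inverse[of \<one>] by (metis one_closed option.inject)
qed

text \<open>The pointwise form of \<open>image_Int\<close>; the direction from right to left uses
  the injectivity of \<open>\<alpha> g\<close>.\<close>

lemma the_\<alpha>_star_mem_iff:
  assumes g: "g \<in> carrier G" and t: "t \<in> carrier G" and \<alpha>: "\<alpha> g x = Some y"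
  shows "x \<in> D t \<longleftrightarrow> y \<in> D (g \<otimes> t)"
proof -
  have x: "x \<in> D (g\<^sup>\<star>)" using \<alpha> dom_\<alpha>[OF g] by blast
  have y: "y \<in> D g" using \<alpha> ran_\<alpha>[OF g] by (metis ranI)
  show ?thesis
  proof
    assume "x \<in> D t"
    then have "the (\<alpha> g x) \<in> (\<lambda>x. the (\<alpha> g x)) ` (D (g\<^sup>\<star>) \<inter> D t)" using x by (intro imageI) simp
    then show "y \<in> D (g \<otimes> t)" unfolding image_Int[OF g t] by (simp add: \<alpha>)
  next
    assume "y \<in> D (g \<otimes> t)"
    then obtain x' where x': "x' \<in> D (g\<^sup>\<star>)" "x' \<in> D t" "y = the (\<alpha> g x')"
      using image_Int[OF g t] y by blast
    then obtain y' where "\<alpha> g x' = Some y'" unfolding dom_\<alpha>[OF g, symmetric] by blast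
    then have "\<alpha> g x' = Some y" using x' by simp
    then have "\<alpha> (g\<^sup>\<star>) y = Some x'" "\<alpha> (g\<^sup>\<star>) y = Some x" using \<alpha> \<alpha>_inverse[OF g] by blast+
    then show "x \<in> D t" using x' by simp
  qed
qed

lemma prefix_product_closed:
  assumes "set gs \<subseteq> carrier G"
  shows "foldr (\<otimes>) (take k gs) \<one> \<in> carrier G"
proof (rule word_product_closed)
  show "set (take k gs) \<subseteq> carrier G" using assms set_take_subset[of k gs] by (rule subset_trans[rotated])
qed

text \<open>Products of closed ideals are intersections. The shift to \<open>Suc k\<close> runs
  through exactly the nonempty prefixes and lets the first letter be split off.\<close>

lemma word_ideal_eq_INT:
  assumes "set gs \<subseteq> carrier G"
  shows "word_ideal G D gs = (\<Inter>k<length gs. D (foldr (\<otimes>) (take (Suc k) gs) \<one>))"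
proof -
  have "word_ideal G D gs =
      \<Inter> (set (map (\<lambda>k. D (foldr (\<otimes>) (take k gs) \<one>)) [1..<length gs + 1]))"
    unfolding word_ideal_def
  proof (rule ideal_products_eq_Inter)
    fix I assume "I \<in> set (map (\<lambda>k. D (foldr (\<otimes>) (take k gs) \<one>)) [1..<length gs + 1])"
    then obtain k where I: "I = D (foldr (\<otimes>) (take k gs) \<one>)" unfolding set_map by (rule imageE)
    show "closed_ideal I" unfolding I by (rule closed_ideal_D[OF prefix_product_closed[OF assms]])
  qed
  moreover have "set [1..<length gs + 1] = Suc ` {..<length gs}"
    by (metis One_nat_def Suc_eq_plus1 atLeast_upt image_Suc_atLeastLessThan lessThan_atLeast0 set_upt)
  ultimately show ?thesis by (simp only: set_map image_image)
qed

lemma word_ideal_Nil: "word_ideal G D [] = UNIV"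
  by (simp add: word_ideal_def)

lemma closed_ideal_word_ideal:
  assumes "set gs \<subseteq> carrier G"
  shows "closed_ideal (word_ideal G D gs)"
  unfolding word_ideal_eq_INT[OF assms]
  using closed_ideal_D[OF prefix_product_closed[OF assms]] by (rule closed_ideal_INT)

text \<open>The prefix \<open>g\<close> contributes the range of \<open>\<alpha> g\<close>. Every
  longer prefix starts with \<open>g\<close>, and its ideal is pulled back along
  \<open>\<alpha> g\<close> to the ideal of a prefix of \<open>gs\<close>.\<close>

lemma word_ideal_Cons:
  assumes g: "g \<in> carrier G" and gs: "set gs \<subseteq> carrier G"
  shows "y \<in> word_ideal G D (g # gs) \<longleftrightarrow> (\<exists>x\<in>word_ideal G D gs. \<alpha> g x = Some y)"
proof -
  have "y \<in> word_ideal G D (g # gs) \<longleftrightarrow>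
      y \<in> D g \<and> (\<forall>k<length gs. y \<in> D (g \<otimes> foldr (\<otimes>) (take (Suc k) gs) \<one>))"
    using g gs by (subst word_ideal_eq_INT) (auto simp: lessThan_Suc_eq_insert_0)
  also have "\<dots> \<longleftrightarrow> (\<exists>x. \<alpha> g x = Some y \<and> (\<forall>k<length gs. x \<in> D (foldr (\<otimes>) (take (Suc k) gs) \<one>)))"
  proof -
    have "y \<in> D g \<longleftrightarrow> (\<exists>x. \<alpha> g x = Some y)" using ran_\<alpha>[OF g] by (auto simp: ran_def)
    then show ?thesis using the_\<alpha>_star_mem_iff[OF g prefix_product_closed[OF gs]] by blast
  qed
  also have "\<dots> \<longleftrightarrow> (\<exists>x\<in>word_ideal G D gs. \<alpha> g x = Some y)"
    using gs by (auto simp: word_ideal_eq_INT)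
  finally show ?thesis .
qed

lemma ran_word_map: "set gs \<subseteq> carrier G \<Longrightarrow> ran (word_map \<alpha> gs) = word_ideal G D gs"
proof (induction gs)
  case (Cons g gs)
  have "ran (\<alpha> g \<circ>\<^sub>m word_map \<alpha> gs) = {y. \<exists>x\<in>ran (word_map \<alpha> gs). \<alpha> g x = Some y}"
    by (auto simp: ran_def map_comp_Some_iff)
  then show ?case using Cons word_ideal_Cons[of g gs] by auto
qed (auto simp: word_ideal_Nil ran_def)

lemma word_map_inverse:
  "set gs \<subseteq> carrier G \<Longrightarrow> word_map \<alpha> gs x = Some y \<longleftrightarrow> word_map \<alpha> (word_star gs) y = Some x"
proof (induction gs arbitrary: y)
  case (Cons g gs)
  then have "\<alpha> g z = Some y \<longleftrightarrow> \<alpha> (g\<^sup>\<star>) y = Some z" for z by (intro \<alpha>_inverse) simp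
  moreover have "word_star (g # gs) = word_star gs @ [g\<^sup>\<star>]" by (simp add: word_star_def)
  ultimately show ?case using Cons by (auto simp: word_map_append map_comp_Some_iff)
qed (auto simp: word_star_def)

lemma dom_word_map:
  assumes "set gs \<subseteq> carrier G"
  shows "dom (word_map \<alpha> gs) = word_ideal G D (word_star gs)"
  using word_map_inverse[OF assms] ran_word_map[OF word_star_closed[OF assms]]
  by (auto simp: ran_def dom_def)

lemma star_isomorphism_word_map:
  "set gs \<subseteq> carrier G \<Longrightarrow>
    star_isomorphism_on (word_ideal G D (word_star gs)) (word_ideal G D gs) (word_map \<alpha> gs)"
proof (induction gs)
  case Nil
  show ?case
    by (auto simp: star_isomorphism_on_def word_star_def word_ideal_Nil bij_betw_def)
next
  case (Cons g gs)
  then have g: "g \<in> carrier G" and gs: "set gs \<subseteq> carrier G" by auto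
  have "closed_ideal (dom (\<alpha> g \<circ>\<^sub>m word_map \<alpha> gs))"
    using Cons.prems dom_word_map[of "g # gs"] closed_ideal_word_ideal[OF word_star_closed, of "g # gs"]
    by simp
  from star_isomorphism_on_comp[OF star_isomorphism[OF g] closed_ideal_D[OF star_closed[OF g]]
      Cons.IH[OF gs] closed_ideal_word_ideal[OF word_star_closed[OF gs]] this]
  show ?case
    using dom_word_map[OF Cons.prems] ran_word_map[OF Cons.prems] by simp
qed

end

lemma rep_spaceI: "a \<in> I \<Longrightarrow> \<pi> a h \<in> rep_space \<pi> I"
  by (auto simp: rep_space_def)

lemma rep_spaceE:
  assumes "k \<in> rep_space \<pi> I"
  obtains a h where "a \<in> I" "k = \<pi> a h"
  using assms by (auto simp: rep_space_def)

section \<open>Products of the partial isometries of a covariant representation\<close>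

context covariant_representation
begin

lemma \<pi>_mult: "\<pi> (a * b) h = \<pi> a (\<pi> b h)"
  using representation by (simp add: star_representation_def)

lemma \<pi>_adjoint: "cinner (\<pi> a h) k = cinner h (\<pi> (star a) k)"
  using representation by (simp add: star_representation_def is_adjoint_def)

lemma adjoint_u: "g \<in> carrier G \<Longrightarrow> adjoint_partial_isometries (u g) (u (g\<^sup>\<star>))"
  by (rule partial_isometry_adjoint)
    (simp_all add: partial_isometry initial_space final_space adjoint star_closed star_star_eq)

lemma u_star_range: "g \<in> carrier G \<Longrightarrow> range (u (g\<^sup>\<star>)) = rep_space \<pi> (D (g\<^sup>\<star>))"
  by (simp add: final_space star_closed)

lemma projection_fixes:
  assumes g: "g \<in> carrier G" and h: "h \<in> rep_space \<pi> (D (g\<^sup>\<star>))"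
  shows "u (g\<^sup>\<star>) (u g h) = h"
proof -
  obtain k where "h = u (g\<^sup>\<star>) k" using h unfolding u_star_range[OF g, symmetric] by (rule rangeE)
  then show ?thesis by (simp add: adjoint_STS[OF adjoint_u[OF g]])
qed

lemma rep_space_mult:
  assumes "closed_ideal I" "h \<in> rep_space \<pi> I"
  shows "\<pi> a h \<in> rep_space \<pi> I"
proof -
  obtain b k where "b \<in> I" "h = \<pi> b k" using assms(2) by (rule rep_spaceE)
  then show ?thesis
    using closed_ideal_mult_left[OF assms(1)] rep_spaceI[of "a * b" I \<pi> k] by (simp add: \<pi>_mult)
qed

text \<open>The range of the projection \<open>Q\<close> is \<open>\<pi>(I)H\<close> for an ideal
  \<open>I\<close>, hence invariant under every \<open>\<pi> b\<close>. Taking adjoints of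
  \<open>Q \<pi>(b) Q = \<pi>(b) Q\<close> for \<open>b = star a\<close> gives
  \<open>Q \<pi>(a) = Q \<pi>(a) Q = \<pi>(a) Q\<close>.\<close>

lemma projection_commutes:
  assumes g: "g \<in> carrier G"
  shows "u (g\<^sup>\<star>) (u g (\<pi> a h)) = \<pi> a (u (g\<^sup>\<star>) (u g h))"
proof (rule cinner_eqI)
  fix m
  define Q where "Q h = u (g\<^sup>\<star>) (u g h)" for h
  have Q: "cinner (Q x) y = cinner x (Q y)" for x y
    using adjoint_cinner[OF adjoint_u[OF g]]
      adjoint_cinner[OF adjoint_partial_isometries_sym[OF adjoint_u[OF g]]]
    by (simp add: Q_def)
  have QaQ: "Q (\<pi> b (Q k)) = \<pi> b (Q k)" for b k
  proof -
    have "Q k \<in> rep_space \<pi> (D (g\<^sup>\<star>))" using u_star_range[OF g] by (auto simp: Q_def)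
    from projection_fixes[OF g rep_space_mult[OF closed_ideal_D[OF star_closed[OF g]] this]]
    show ?thesis by (simp add: Q_def)
  qed
  have "cinner (Q (\<pi> a h)) m = cinner h (\<pi> (star a) (Q m))" by (simp add: Q \<pi>_adjoint)
  also have "\<dots> = cinner h (Q (\<pi> (star a) (Q m)))" by (simp only: QaQ)
  also have "\<dots> = cinner (Q (\<pi> a (Q h))) m"
    by (simp add: Q \<pi>_adjoint)
  finally show "cinner (u (g\<^sup>\<star>) (u g (\<pi> a h))) m = cinner (\<pi> a (u (g\<^sup>\<star>) (u g h))) m"
    unfolding QaQ by (simp add: Q_def)
qed

text \<open>The intertwining form of \<open>covariance\<close>: \<open>\<pi> a h\<close> lies in the
  initial space of \<open>u g\<close>, so the initial projection can be inserted and moved past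
  \<open>\<pi> a\<close>.\<close>

lemma u_\<pi>:
  assumes g: "g \<in> carrier G" and a: "\<alpha> g a = Some b"
  shows "u g (\<pi> a h) = \<pi> b (u g h)"
proof -
  have aD: "a \<in> D (g\<^sup>\<star>)" using a dom_\<alpha>[OF g] by blast
  then have "\<pi> a h = u (g\<^sup>\<star>) (u g (\<pi> a h))"
    using projection_fixes[OF g rep_spaceI] by simp
  then have "u g (\<pi> a h) = u g (\<pi> a (u (g\<^sup>\<star>) (u g h)))"
    by (simp add: projection_commutes[OF g])
  also have "\<dots> = \<pi> b (u g h)"
    using fun_cong[OF covariance[OF g aD], of "u g h"] a by simp
  finally show ?thesis .
qed

lemma ideal_product_D_Int:
  "s \<in> carrier G \<Longrightarrow> t \<in> carrier G \<Longrightarrow> ideal_product (D s) (D t) = D s \<inter> D t"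
  by (simp add: ideal_product_eq_Int closed_ideal_D)

text \<open>Nondegeneracy only gives a dense span, but this set is the initial space of
  \<open>u \<one>\<close>, an orthogonal complement, and so already a closed subspace.\<close>

lemma rep_space_UNIV: "rep_space \<pi> UNIV = UNIV"
proof -
  have eq: "rep_space \<pi> UNIV = initial_space (u \<one>)"
    by (simp add: initial_space star_one D_one)
  have "closure (cspan (initial_space (u \<one>))) \<subseteq> initial_space (u \<one>)"
    unfolding initial_space_def
    by (intro closure_minimal complex_vector.span_minimal order_refl
        csubspace_orthogonal_complement closed_orthogonal_complement)
  then show ?thesis using nondegenerate by (auto simp: nondegenerate_def eq)
qed

lemma u_one: "u \<one> = id"
proof
  fix h
  have "u (\<one> \<otimes> \<one>) h = u \<one> (u \<one> h)"
    by (intro multiplicative)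
      (simp_all add: ideal_product_eq_Int closed_ideal_UNIV D_one star_one rep_space_UNIV)
  then show "u \<one> h = id h"
    using projection_fixes[of \<one> h] by (simp add: star_one D_one rep_space_UNIV)
qed

lemma range_word_op:
  "set gs \<subseteq> carrier G \<Longrightarrow> range (word_op u gs) = rep_space \<pi> (word_ideal G D gs)"
proof (induction gs)
  case (Cons g gs)
  then have g: "g \<in> carrier G" and gs: "set gs \<subseteq> carrier G"
    and IH: "range (word_op u gs) = rep_space \<pi> (word_ideal G D gs)" by auto
  show ?case
  proof (intro equalityI subsetI)
    fix k assume "k \<in> range (word_op u (g # gs))"
    then obtain h where h: "h \<in> rep_space \<pi> (word_ideal G D gs)" and k: "k = u g h"
      unfolding IH[symmetric] by auto
    obtain a h' where a: "a \<in> word_ideal G D gs" and h': "h = \<pi> a h'"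
      using h by (rule rep_spaceE)
    \<comment> \<open>Projecting \<open>h'\<close> onto the initial space of \<open>u g\<close>
      supplies a factor \<open>d\<close> from \<open>D (g\<^sup>\<star>)\<close>, which puts
      \<open>a * d\<close> into both ideals and thus into the domain of
      \<open>\<alpha> g\<close>.\<close>
    obtain d m where d: "d \<in> D (g\<^sup>\<star>)" and m: "u (g\<^sup>\<star>) (u g h') = \<pi> d m"
      using u_star_range[OF g] by (metis rangeI rep_spaceE)
    have "k = u g (u (g\<^sup>\<star>) (u g (\<pi> a h')))"
      by (simp add: k h' adjoint_TST[OF adjoint_u[OF g]])
    then have k': "k = u g (\<pi> (a * d) m)" by (simp add: projection_commutes[OF g] m \<pi>_mult)
    have "a * d \<in> D (g\<^sup>\<star>)"
      using closed_ideal_mult_left[OF closed_ideal_D[OF star_closed[OF g]] d] .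
    then obtain b where b: "\<alpha> g (a * d) = Some b" using dom_\<alpha>[OF g] by auto
    have "b \<in> word_ideal G D (g # gs)"
      using b a by (auto simp: word_ideal_Cons[OF g gs]
          intro!: bexI[of _ "a * d"] closed_ideal_mult_right closed_ideal_word_ideal[OF gs])
    then show "k \<in> rep_space \<pi> (word_ideal G D (g # gs))"
      unfolding k' u_\<pi>[OF g b] by (rule rep_spaceI)
  next
    fix k assume "k \<in> rep_space \<pi> (word_ideal G D (g # gs))"
    then obtain b h where b: "b \<in> word_ideal G D (g # gs)" and k: "k = \<pi> b h"
      by (rule rep_spaceE)
    from b obtain a where a: "a \<in> word_ideal G D gs" "\<alpha> g a = Some b"
      by (auto simp: word_ideal_Cons[OF g gs])
    have "a \<in> D (g\<^sup>\<star>)" using a dom_\<alpha>[OF g] by blast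
    then have "k = u g (\<pi> a (u (g\<^sup>\<star>) h))"
      using fun_cong[OF covariance[OF g], of a h] a by (simp add: k)
    moreover have "\<pi> a (u (g\<^sup>\<star>) h) \<in> range (word_op u gs)"
      unfolding IH using a(1) by (rule rep_spaceI)
    then obtain m where "\<pi> a (u (g\<^sup>\<star>) h) = word_op u gs m" by (rule rangeE)
    ultimately have "k = word_op u (g # gs) m" by simp
    then show "k \<in> range (word_op u (g # gs))" by (rule range_eqI)
  qed
qed (simp add: word_ideal_Nil rep_space_UNIV)

text \<open>The range of the tail has the form \<open>\<pi>(I)H\<close>. It is invariant under the
  initial projection of \<open>u g\<close>, which commutes with \<open>\<pi>\<close>; hence the two
  projections commute and the product is again a partial isometry.\<close>

lemma adjoint_word_op:
  "set gs \<subseteq> carrier G \<Longrightarrow> adjoint_partial_isometries (word_op u gs) (word_op u (word_star gs))"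
proof (induction gs)
  case (Cons g gs)
  then have g: "g \<in> carrier G" and gs: "set gs \<subseteq> carrier G" by auto
  note IH = Cons.IH[OF gs]
  have "u (g\<^sup>\<star>) (u g (word_op u gs h)) \<in> range (word_op u gs)" for h
  proof -
    have "word_op u gs h \<in> rep_space \<pi> (word_ideal G D gs)"
      unfolding range_word_op[OF gs, symmetric] by (rule rangeI)
    then obtain a k where "a \<in> word_ideal G D gs" "word_op u gs h = \<pi> a k" by (rule rep_spaceE)
    then have "u (g\<^sup>\<star>) (u g (word_op u gs h)) \<in> rep_space \<pi> (word_ideal G D gs)"
      using rep_spaceI[of a _ \<pi>] by (simp add: projection_commutes[OF g])
    then show ?thesis by (simp only: range_word_op[OF gs])
  qed
  note comm = adjoint_projections_commute[of "u g" "u (g\<^sup>\<star>)" "word_op u gs" "word_op u (word_star gs)",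
      OF adjoint_u[OF g] IH this]
  have "adjoint_partial_isometries (u g \<circ> word_op u gs) (word_op u (word_star gs) \<circ> u (g\<^sup>\<star>))"
    using adjoint_partial_isometries_comp[of "u g" "u (g\<^sup>\<star>)" "word_op u gs"
        "word_op u (word_star gs)", OF adjoint_u[OF g] IH comm] .
  then show ?case by (simp add: word_star_def word_op_append o_def)
qed (simp add: word_star_def adjoint_partial_isometries_id)

lemma word_op_covariance:
  "set gs \<subseteq> carrier G \<Longrightarrow> word_map \<alpha> gs a = Some b \<Longrightarrow>
    word_op u gs (\<pi> a (word_op u (word_star gs) h)) = \<pi> b h"
proof (induction gs arbitrary: b h)
  case (Cons g gs)
  then obtain c where c: "word_map \<alpha> gs a = Some c" "\<alpha> g c = Some b"
    by (auto simp: map_comp_Some_iff)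
  have g: "g \<in> carrier G" using Cons.prems by simp
  have "c \<in> D (g\<^sup>\<star>)" using c dom_\<alpha>[OF g] by blast
  then have "u g (\<pi> c (u (g\<^sup>\<star>) h)) = \<pi> b h"
    using fun_cong[OF covariance[OF g], of c h] c by simp
  moreover have "word_op u gs (\<pi> a (word_op u (word_star gs) k)) = \<pi> c k" for k
    using Cons.IH[OF _ c(1)] Cons.prems(1) by simp
  moreover have "word_star (g # gs) = word_star gs @ [g\<^sup>\<star>]" by (simp add: word_star_def)
  ultimately show ?case by (simp add: word_op_append)
qed (simp add: word_star_def)

end

section \<open>The inverse semigroup of words\<close>

lemma map_comp_eqI:
  assumes "\<And>x y. f x = Some y \<longleftrightarrow> g x = Some y"
  shows "f = g"
proof
  fix x
  show "f x = g x"
  proof (cases "f x")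
    case None
    then show ?thesis using assms[THEN iffD2, of x] by (cases "g x") simp_all
  next
    case (Some y)
    then show ?thesis using assms[THEN iffD1, of x y] by simp
  qed
qed

text \<open>Because \<open>f\<close> is injective, \<open>f g f = f\<close> makes \<open>g\<close>
  an extension of the inverse \<open>f'\<close>. With the roles exchanged, \<open>f\<close> extends
  the inverse of \<open>g\<close>, which gives the other inclusion.\<close>

lemma partial_inverse_unique:
  fixes f g f' g' :: "'a \<rightharpoonup> 'a"
  assumes f': "\<And>x y. f x = Some y \<longleftrightarrow> f' y = Some x"
    and g': "\<And>x y. g x = Some y \<longleftrightarrow> g' y = Some x"
    and fgf: "f \<circ>\<^sub>m (g \<circ>\<^sub>m f) = f" and gfg: "g \<circ>\<^sub>m (f \<circ>\<^sub>m g) = g"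
  shows "g = f'"
proof -
  have sub: "q y = Some x"
    if p': "\<And>x y. p x = Some y \<longleftrightarrow> p' y = Some x" and pqp: "p \<circ>\<^sub>m (q \<circ>\<^sub>m p) = p"
      and y: "p x = Some y" for p q p' :: "'a \<rightharpoonup> 'a" and x y
  proof -
    have pqp': "(p \<circ>\<^sub>m (q \<circ>\<^sub>m p)) x = Some y" unfolding pqp by (rule y)
    show ?thesis
    proof (cases "q y")
      case None
      then show ?thesis using pqp' by (simp add: map_comp_def y)
    next
      case (Some z)
      then have "p z = Some y" using pqp' by (simp add: map_comp_def y)
      then have "p' y = Some z" by (rule p'[THEN iffD1])
      moreover have "p' y = Some x" using y by (rule p'[THEN iffD1])
      ultimately show ?thesis using Some by simp
    qed
  qed
  show ?thesis
  proof (rule map_comp_eqI, rule iffI)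
    fix x y
    assume "g y = Some x"
    then have "f x = Some y" by (rule sub[of g g' f, OF g' gfg])
    then show "f' y = Some x" by (rule f'[THEN iffD1])
  next
    fix x y
    assume "f' y = Some x"
    then have "f x = Some y" by (rule f'[THEN iffD2])
    then show "g y = Some x" by (rule sub[of f f' g, OF f' fgf])
  qed
qed

lemma map_comp_inverse_map_comp:
  assumes "\<And>x y. f x = Some y \<longleftrightarrow> g y = Some x"
  shows "f \<circ>\<^sub>m (g \<circ>\<^sub>m f) = f"
proof
  fix x
  show "(f \<circ>\<^sub>m (g \<circ>\<^sub>m f)) x = f x"
  proof (cases "f x")
    case (Some y)
    then have "g y = Some x" using assms by simp
    with Some show ?thesis by simp
  qed simp
qed

text \<open>This becomes the axiom \<open>image_Int\<close> once the ideals are known to be the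
  ranges of the partial maps.\<close>

lemma image_dom_Int_ran: "(\<lambda>x. the (f x)) ` (dom f \<inter> ran g) = ran f \<inter> ran (f \<circ>\<^sub>m g)"
proof (intro equalityI subsetI)
  fix y assume "y \<in> (\<lambda>x. the (f x)) ` (dom f \<inter> ran g)"
  then obtain x w where xw: "f x = Some y" "g w = Some x" by (auto simp: ran_def)
  then have "(f \<circ>\<^sub>m g) w = Some y" by simp
  then show "y \<in> ran f \<inter> ran (f \<circ>\<^sub>m g)" using xw by (intro IntI ranI)
next
  fix y assume "y \<in> ran f \<inter> ran (f \<circ>\<^sub>m g)"
  then obtain x w where xw: "f x = Some y" "g w = Some x"
    by (auto simp: ran_def map_comp_Some_iff)
  then have "x \<in> dom f \<inter> ran g" by (intro IntI domI ranI)
  then show "y \<in> (\<lambda>x. the (f x)) ` (dom f \<inter> ran g)" using xw by (intro image_eqI[of _ _ x]) simp_all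
qed

section \<open>The generated semigroup, its action and its covariant representations\<close>

context covariant_representation
begin

abbreviation "S \<equiv> S_of G \<alpha> u"
abbreviation "E \<equiv> E_of G D \<alpha> u"
abbreviation "element \<equiv> word_element \<alpha> u"

text \<open>\<open>words\<close> excludes the empty word, but \<open>[]\<close> and
  \<open>[\<one>]\<close> give the same element by \<open>\<alpha>_one\<close> and
  \<open>u_one\<close>. Later arguments may therefore use all words.\<close>

lemma element_in_S:
  assumes "set gs \<subseteq> carrier G"
  shows "element gs \<in> carrier S"
proof (cases "gs = []")
  case True
  then have "element gs = element [\<one>]" by (simp add: word_element_eq \<alpha>_one u_one)
  moreover have "[\<one>] \<in> words G" by (simp add: words_def)
  ultimately show ?thesis by (simp add: S_of_def)
next
  case False
  then show ?thesis using assms by (simp add: S_of_def words_def)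
qed

lemma S_cases:
  assumes "s \<in> carrier S"
  obtains gs where "set gs \<subseteq> carrier G" "s = element gs"
  using assms by (auto simp: S_of_def words_def)

lemma S_mult: "s \<otimes>\<^bsub>S\<^esub> t = (fst s \<circ>\<^sub>m fst t, snd s \<circ> snd t)"
  by (simp add: S_of_def)

lemma fst_element: "fst (element gs) = word_map \<alpha> gs"
  by (simp add: word_element_eq)

lemma element_append: "element (gs @ hs) = element gs \<otimes>\<^bsub>S\<^esub> element hs"
  by (simp add: S_mult word_element_eq word_map_append word_op_append)

lemma S_one: "\<one>\<^bsub>S\<^esub> = element []"
  by (simp add: S_of_def word_element_eq \<alpha>_one u_one)

lemma element_star_inverse:
  assumes gs: "set gs \<subseteq> carrier G"
  shows "element gs \<otimes>\<^bsub>S\<^esub> element (word_star gs) \<otimes>\<^bsub>S\<^esub> element gs = element gs"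
proof -
  have "word_map \<alpha> gs \<circ>\<^sub>m (word_map \<alpha> (word_star gs) \<circ>\<^sub>m word_map \<alpha> gs) = word_map \<alpha> gs"
    by (rule map_comp_inverse_map_comp[OF word_map_inverse[OF gs]])
  moreover have "word_op u gs \<circ> (word_op u (word_star gs) \<circ> word_op u gs) = word_op u gs"
    using adjoint_TST[OF adjoint_word_op[OF gs]] by (simp add: fun_eq_iff)
  ultimately show ?thesis by (simp add: S_mult word_element_eq map_comp_assoc comp_assoc)
qed

text \<open>Uniqueness is checked in each coordinate: the first holds partial injections, the second
  partial isometries, whose generalized inverse within the same class is the adjoint.\<close>

lemma element_inverse_unique:
  assumes gs: "set gs \<subseteq> carrier G" and hs: "set hs \<subseteq> carrier G"
    and "element gs \<otimes>\<^bsub>S\<^esub> element hs \<otimes>\<^bsub>S\<^esub> element gs = element gs"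
    and "element hs \<otimes>\<^bsub>S\<^esub> element gs \<otimes>\<^bsub>S\<^esub> element hs = element hs"
  shows "element hs = element (word_star gs)"
proof -
  have "word_map \<alpha> hs = word_map \<alpha> (word_star gs)"
    using assms by (intro partial_inverse_unique[OF word_map_inverse[OF gs] word_map_inverse[OF hs]])
      (simp_all add: S_mult word_element_eq map_comp_assoc)
  moreover have "word_op u hs = word_op u (word_star gs)"
    using assms by (intro adjoint_unique_inverse[OF adjoint_word_op[OF gs] adjoint_word_op[OF hs]])
      (simp_all add: S_mult word_element_eq fun_eq_iff)
  ultimately show ?thesis by (simp add: word_element_eq)
qed

lemma unital_inverse_semigroup_S: "unital_inverse_semigroup S"
proof -
  have mult_closed: "s \<otimes>\<^bsub>S\<^esub> t \<in> carrier S" if "s \<in> carrier S" "t \<in> carrier S" for s t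
    using that by (elim S_cases) (simp add: element_in_S flip: element_append)
  have "monoid S"
  proof
    show "\<one>\<^bsub>S\<^esub> \<otimes>\<^bsub>S\<^esub> s = s" "s \<otimes>\<^bsub>S\<^esub> \<one>\<^bsub>S\<^esub> = s" if "s \<in> carrier S" for s
      using that by (simp_all add: S_one S_mult word_element_eq)
    show "\<one>\<^bsub>S\<^esub> \<in> carrier S" by (simp add: S_one element_in_S)
    show "r \<otimes>\<^bsub>S\<^esub> s \<otimes>\<^bsub>S\<^esub> t = r \<otimes>\<^bsub>S\<^esub> (s \<otimes>\<^bsub>S\<^esub> t)" for r s t
      by (simp add: S_mult map_comp_assoc comp_assoc)
  qed (rule mult_closed)
  then show ?thesis
  proof (rule unital_inverse_semigroup.intro, unfold_locales)
    fix s assume "s \<in> carrier S"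
    then obtain gs where gs: "set gs \<subseteq> carrier G" "s = element gs" by (rule S_cases)
    show "\<exists>!t. t \<in> carrier S \<and> s \<otimes>\<^bsub>S\<^esub> t \<otimes>\<^bsub>S\<^esub> s = s \<and> t \<otimes>\<^bsub>S\<^esub> s \<otimes>\<^bsub>S\<^esub> t = t"
    proof (rule ex1I[of _ "element (word_star gs)"])
      show "element (word_star gs) \<in> carrier S \<and> s \<otimes>\<^bsub>S\<^esub> element (word_star gs) \<otimes>\<^bsub>S\<^esub> s = s \<and>
          element (word_star gs) \<otimes>\<^bsub>S\<^esub> s \<otimes>\<^bsub>S\<^esub> element (word_star gs) = element (word_star gs)"
        using element_star_inverse[OF gs(1)] element_star_inverse[OF word_star_closed[OF gs(1)]] gs
        by (simp add: element_in_S word_star_closed word_star_word_star)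
    next
      fix t assume t: "t \<in> carrier S \<and> s \<otimes>\<^bsub>S\<^esub> t \<otimes>\<^bsub>S\<^esub> s = s \<and> t \<otimes>\<^bsub>S\<^esub> s \<otimes>\<^bsub>S\<^esub> t = t"
      then obtain hs where "set hs \<subseteq> carrier G" "t = element hs" by (auto elim: S_cases)
      then show "t = element (word_star gs)" using element_inverse_unique[OF gs(1)] gs t by simp
    qed
  qed
qed

lemma S_star:
  assumes gs: "set gs \<subseteq> carrier G"
  shows "(element gs)\<^sup>\<star>\<^bsub>S\<^esub> = element (word_star gs)"
  using element_star_inverse[OF gs] element_star_inverse[OF word_star_closed[OF gs]] gs
  by (intro unital_inverse_semigroup.star_eqI[OF unital_inverse_semigroup_S])
    (simp_all add: element_in_S word_star_closed word_star_word_star)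

text \<open>Words with the same element have the same partial map, and its range is their ideal, so
  the description in \<open>E_of\<close> has a unique solution.\<close>

lemma E_element:
  assumes gs: "set gs \<subseteq> carrier G"
  shows "E (element gs) = word_ideal G D gs"
proof -
  have unique: "word_ideal G D hs = word_ideal G D gs"
    if hs: "hs \<in> words G" "element gs = element hs" for hs
  proof -
    have "word_map \<alpha> gs = word_map \<alpha> hs" using arg_cong[OF hs(2), of fst] by (simp only: fst_element)
    moreover have "set hs \<subseteq> carrier G" using hs(1) by (simp add: words_def)
    ultimately show ?thesis using ran_word_map[OF gs] ran_word_map[of hs] by simp
  qed
  \<comment> \<open>\<open>gs\<close> may be empty and so lie outside \<open>words G\<close>; a
    nonempty word with the same element is the witness.\<close>
  have "element gs \<in> element ` words G" using element_in_S[OF gs] by (simp add: S_of_def)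
  then obtain hs where hs: "element gs = element hs" "hs \<in> words G" by (rule imageE)
  show ?thesis
    unfolding E_of_def
  proof (rule the_equality)
    show "\<exists>hs\<in>words G. element gs = element hs \<and> word_ideal G D gs = word_ideal G D hs"
      using hs unique[OF hs(2,1)] by auto
    show "I = word_ideal G D gs"
      if "\<exists>hs\<in>words G. element gs = element hs \<and> I = word_ideal G D hs" for I
      using that unique by auto
  qed
qed

lemma E_eq_ran: "s \<in> carrier S \<Longrightarrow> E s = ran (fst s)"
  by (elim S_cases) (simp add: E_element fst_element ran_word_map)

lemma closed_ideal_E: "s \<in> carrier S \<Longrightarrow> closed_ideal (E s)"
  by (elim S_cases) (simp add: E_element closed_ideal_word_ideal)

text \<open>Multiplication in \<open>S\<close> composes the first coordinates, so
  \<open>comp\<close> holds for every argument; \<open>image_Int\<close> reduces to a statement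
  about ranges.\<close>

lemma partial_action_S: "partial_action S E \<beta>_of"
proof -
  interpret S: unital_inverse_semigroup S by (rule unital_inverse_semigroup_S)
  have inv: "fst s x = Some y \<longleftrightarrow> fst (s\<^sup>\<star>\<^bsub>S\<^esub>) y = Some x" if s: "s \<in> carrier S" for s x y
  proof -
    obtain gs where gs: "set gs \<subseteq> carrier G" "s = element gs" using s by (rule S_cases)
    show ?thesis unfolding gs(2) S_star[OF gs(1)] fst_element by (rule word_map_inverse[OF gs(1)])
  qed
  show ?thesis
  proof (unfold_locales, unfold \<beta>_of_def)
    show "E \<one>\<^bsub>S\<^esub> = UNIV" by (simp add: S_one E_element word_ideal_Nil)
    show "star_isomorphism_on (E (s\<^sup>\<star>\<^bsub>S\<^esub>)) (E s) (fst s)" if "s \<in> carrier S" for s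
      using that by (elim S_cases)
        (simp add: S_star E_element word_star_closed fst_element star_isomorphism_word_map)
    show "(Map.graph (fst s))\<inverse> = Map.graph (fst (s\<^sup>\<star>\<^bsub>S\<^esub>))" if "s \<in> carrier S" for s
      using inv[OF that] by (auto simp: Map.graph_def)
    show "(\<lambda>x. the (fst s x)) ` (E (s\<^sup>\<star>\<^bsub>S\<^esub>) \<inter> E t) = E s \<inter> E (s \<otimes>\<^bsub>S\<^esub> t)"
      if st: "s \<in> carrier S" "t \<in> carrier S" for s t
    proof -
      have "E (s\<^sup>\<star>\<^bsub>S\<^esub>) = dom (fst s)"
        unfolding E_eq_ran[OF S.star_closed[OF st(1)]] by (simp add: ran_def dom_def flip: inv[OF st(1)])
      moreover have "E (s \<otimes>\<^bsub>S\<^esub> t) = ran (fst s \<circ>\<^sub>m fst t)"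
        using E_eq_ran[OF S.m_closed[OF st]] by (simp add: S_mult)
      ultimately show ?thesis
        by (simp only: E_eq_ran[OF st(1)] E_eq_ran[OF st(2)] image_dom_Int_ran)
    qed
  qed (simp_all add: closed_ideal_E S_mult)
qed

text \<open>The axioms for a single \<open>s\<close> are read off from a word for it.
  \<open>multiplicative\<close> holds for every vector, since multiplication in \<open>S\<close>
  composes the second coordinates.\<close>

lemma covariant_representation_S: "covariant_representation S E \<beta>_of \<pi> \<nu>_of"
proof -
  interpret S: partial_action S E \<beta>_of by (rule partial_action_S)
  show ?thesis
  proof (unfold_locales, unfold \<nu>_of_def \<beta>_of_def)
    fix s assume s: "s \<in> carrier S"
    then obtain gs where gs: "set gs \<subseteq> carrier G" and s_eq: "s = element gs" by (rule S_cases)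
    have snd: "snd s = word_op u gs" "snd (s\<^sup>\<star>\<^bsub>S\<^esub>) = word_op u (word_star gs)"
      and fst: "fst s = word_map \<alpha> gs"
      and Es: "E s = word_ideal G D gs" "E (s\<^sup>\<star>\<^bsub>S\<^esub>) = word_ideal G D (word_star gs)"
      using gs by (simp_all add: s_eq S_star E_element word_star_closed)
        (simp_all add: word_element_eq)
    note adj = adjoint_word_op[OF gs]
    show "partial_isometry (snd s)" using adjoint_partial_isometry[OF adj] snd by simp
    show "initial_space (snd s) = rep_space \<pi> (E (s\<^sup>\<star>\<^bsub>S\<^esub>))"
      using adjoint_initial_space[OF adj] range_word_op[OF word_star_closed[OF gs]] snd Es by simp
    show "final_space (snd s) = rep_space \<pi> (E s)"
      using range_word_op[OF gs] snd Es by simp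
    show "snd s \<circ> \<pi> a \<circ> snd (s\<^sup>\<star>\<^bsub>S\<^esub>) = \<pi> (the (fst s a))" if "a \<in> E (s\<^sup>\<star>\<^bsub>S\<^esub>)" for a
    proof -
      obtain b where b: "word_map \<alpha> gs a = Some b"
        using \<open>a \<in> E (s\<^sup>\<star>\<^bsub>S\<^esub>)\<close> unfolding Es dom_word_map[OF gs, symmetric] by blast
      show ?thesis using word_op_covariance[OF gs b] by (simp add: snd fst b fun_eq_iff)
    qed
    show "is_adjoint (snd (s\<^sup>\<star>\<^bsub>S\<^esub>)) (snd s)"
      using adj by (simp add: snd adjoint_partial_isometries_def)
  qed (simp_all add: representation nondegenerate S_mult)
qed

text \<open>The main work is \<open>multiplicative\<close>. The elements \<open>\<mu>\<close> of
  \<open>s \<otimes> t\<close> and \<open>\<sigma> \<tau>\<close> of the word \<open>[s, t]\<close>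
  may differ, but \<open>\<mu> \<epsilon> = \<sigma> \<tau>\<close> for an idempotent
  \<open>\<epsilon>\<close> with \<open>z \<epsilon> h = h\<close>. Hence \<open>z \<mu> h = z \<mu>
  (z \<epsilon> h) = z (\<sigma> \<tau>) h = z \<sigma> (z \<tau> h)\<close>.\<close>

lemma covariant_representation_restrict:
  assumes z: "covariant_representation S E \<beta>_of \<rho> z"
  shows "covariant_representation G D \<alpha> \<rho> (\<lambda>g. z (\<alpha> g, u g))"
proof -
  interpret S: covariant_representation S E \<beta>_of \<rho> z by (rule z)
  have single: "(\<alpha> g, u g) = element [g]" for g by (simp add: word_element_eq)
  have star: "(\<alpha> g, u g)\<^sup>\<star>\<^bsub>S\<^esub> = (\<alpha> (g\<^sup>\<star>), u (g\<^sup>\<star>))" if "g \<in> carrier G" for g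
    using that by (simp add: single S_star word_star_def)
  have mem: "(\<alpha> g, u g) \<in> carrier S" if "g \<in> carrier G" for g
    using that by (simp add: single element_in_S)
  have E: "E (\<alpha> g, u g) = D g" if "g \<in> carrier G" for g
    using that E_eq_ran[OF mem[OF that]] by (simp add: ran_\<alpha>)
  show ?thesis
  proof
    fix s t h
    assume s: "s \<in> carrier G" and t: "t \<in> carrier G"
      and "h \<in> rep_space \<rho> (ideal_product (D (t\<^sup>\<star>)) (D (t\<^sup>\<star> \<otimes> s\<^sup>\<star>)))"
    then have h: "h \<in> rep_space \<rho> (D (t\<^sup>\<star>) \<inter> D (t\<^sup>\<star> \<otimes> s\<^sup>\<star>))"
      by (simp add: ideal_product_D_Int star_closed)
    have st: "set [s, t] \<subseteq> carrier G" using s t by simp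
    have ws: "word_star [s, t] = [t\<^sup>\<star>, s\<^sup>\<star>]" by (simp add: word_star_def)
    have I: "word_ideal G D [t\<^sup>\<star>, s\<^sup>\<star>] = D (t\<^sup>\<star>) \<inter> D (t\<^sup>\<star> \<otimes> s\<^sup>\<star>)"
      using s t by (subst word_ideal_eq_INT) (auto simp: star_closed lessThan_Suc)
    define I where "I = D (t\<^sup>\<star>) \<inter> D (t\<^sup>\<star> \<otimes> s\<^sup>\<star>)"
    \<comment> \<open>The initial idempotent of \<open>\<sigma> \<tau>\<close>, that is, its inverse
      times itself; its first coordinate is the identity on \<open>I\<close>.\<close>
    define \<epsilon> where "\<epsilon> = element (word_star [s, t] @ [s, t])"
    define \<sigma> \<tau> \<mu> where "\<sigma> = element [s]" and "\<tau> = element [t]" and "\<mu> = element [s \<otimes> t]"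
    note defs = \<sigma>_def \<tau>_def \<mu>_def
    have carrier: "\<sigma> \<in> carrier S" "\<tau> \<in> carrier S" "\<mu> \<in> carrier S" "\<epsilon> \<in> carrier S"
      using s t by (simp_all add: defs \<epsilon>_def ws element_in_S star_closed)
    have \<sigma>\<tau>: "\<sigma> \<otimes>\<^bsub>S\<^esub> \<tau> = element [s, t]" by (simp add: defs flip: element_append)
    have \<alpha>st: "word_map \<alpha> [s, t] x = \<alpha> (s \<otimes> t) x" if "x \<in> I" for x
      using comp[OF s t, of x] that by (simp add: I_def)
    have dom_st: "dom (word_map \<alpha> [s, t]) = I"
      using dom_word_map[OF st] I by (simp add: I_def ws)
    have \<epsilon>_map: "fst \<epsilon> x = Some y \<longleftrightarrow> x = y \<and> x \<in> I" for x y
      unfolding dom_st[symmetric] \<epsilon>_def word_element_eq word_map_append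
      using word_map_inverse[OF st] by (auto simp: map_comp_Some_iff simp del: word_map_simps)
    have E\<epsilon>: "E \<epsilon> = I" using \<epsilon>_map by (auto simp: E_eq_ran carrier ran_def)
    have \<epsilon>_star: "\<epsilon>\<^sup>\<star>\<^bsub>S\<^esub> = \<epsilon>"
      using s t by (simp add: \<epsilon>_def S_star star_closed ws) (simp add: word_star_def star_star_eq)
    have "\<epsilon> \<otimes>\<^bsub>S\<^esub> \<epsilon> = \<epsilon>"
    proof -
      have "element (word_star [s, t]) \<otimes>\<^bsub>S\<^esub> element [s, t] \<otimes>\<^bsub>S\<^esub> element (word_star [s, t]) =
          element (word_star [s, t])"
        using element_star_inverse[OF word_star_closed[OF st]] by (simp add: word_star_word_star[OF st])
      moreover have "a \<otimes>\<^bsub>S\<^esub> b \<otimes>\<^bsub>S\<^esub> (a \<otimes>\<^bsub>S\<^esub> b) = a \<otimes>\<^bsub>S\<^esub> b \<otimes>\<^bsub>S\<^esub> a \<otimes>\<^bsub>S\<^esub> b" for a b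
        by (simp add: S_mult map_comp_assoc comp_assoc)
      ultimately show ?thesis by (simp only: \<epsilon>_def element_append)
    qed
    moreover have "ideal_product (E \<epsilon>) (E \<epsilon>) = I"
      using closed_ideal_E[OF carrier(4)] by (simp add: ideal_product_eq_Int E\<epsilon>)
    \<comment> \<open>\<open>multiplicative\<close> for the pair \<open>\<epsilon>\<close>,
      \<open>\<epsilon>\<close> makes \<open>z \<epsilon>\<close> idempotent on \<open>h\<close>; as
      \<open>\<epsilon>\<close> is its own inverse, \<open>z \<epsilon>\<close> applied twice is
      also the projection that fixes \<open>h\<close>.\<close>
    ultimately have "z \<epsilon> h = z \<epsilon> (z \<epsilon> h)"
      using S.multiplicative[OF carrier(4) carrier(4), of h] h by (simp add: \<epsilon>_star I_def)
    also have "\<dots> = h"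
      using S.projection_fixes[OF carrier(4), of h] h by (simp add: \<epsilon>_star E\<epsilon> I_def)
    finally have z\<epsilon>: "z \<epsilon> h = h" .
    \<comment> \<open>\<open>\<alpha>\<^bsub>s\<^esub> \<alpha>\<^bsub>t\<^esub>\<close> and \<open>u\<^bsub>s\<^esub> u\<^bsub>t\<^esub>\<close> are the restrictions of \<open>\<alpha>\<^bsub>st\<^esub>\<close> and \<open>u\<^bsub>st\<^esub>\<close> along the
      idempotent \<open>\<epsilon>\<close>.\<close>
    have "\<mu> \<otimes>\<^bsub>S\<^esub> \<epsilon> = \<sigma> \<otimes>\<^bsub>S\<^esub> \<tau>"
    proof -
      have "fst \<mu> \<circ>\<^sub>m fst \<epsilon> = word_map \<alpha> [s, t]"
      proof (rule map_comp_eqI)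
        fix x y
        have "word_map \<alpha> [s, t] x = Some y \<longleftrightarrow> x \<in> I \<and> \<alpha> (s \<otimes> t) x = Some y"
          using \<alpha>st dom_st by (metis domI)
        then show "(fst \<mu> \<circ>\<^sub>m fst \<epsilon>) x = Some y \<longleftrightarrow> word_map \<alpha> [s, t] x = Some y"
          by (auto simp: map_comp_Some_iff \<epsilon>_map \<mu>_def word_element_eq simp del: word_map_simps(2))
            (auto simp: map_comp_Some_iff)
      qed
      moreover have "u (s \<otimes> t) (word_op u (word_star [s, t]) (word_op u [s, t] k)) = word_op u [s, t] k" for k
      proof -
        let ?k = "word_op u (word_star [s, t]) (word_op u [s, t] k)"
        \<comment> \<open>The range of the operator of \<open>word_star [s, t]\<close> is exactly
          the space on which the original \<open>multiplicative\<close> relates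
          \<open>u (s \<otimes> t)\<close> to \<open>u s\<close> and \<open>u t\<close>.\<close>
        have "?k \<in> rep_space \<pi> I"
          using range_word_op[OF word_star_closed[OF st]] I ws by (simp add: I_def) (metis rangeI)
        then have "u (s \<otimes> t) ?k = word_op u [s, t] ?k"
          using multiplicative[OF s t, of ?k] s t by (simp add: I_def ideal_product_D_Int star_closed)
        also have "\<dots> = word_op u [s, t] k" by (rule adjoint_TST[OF adjoint_word_op[OF st]])
        finally show ?thesis .
      qed
      then have "snd \<mu> \<circ> snd \<epsilon> = word_op u [s, t]"
        by (simp add: \<mu>_def \<epsilon>_def word_element_eq word_op_append fun_eq_iff del: word_op_simps(2))
          (simp add: fun_eq_iff)
      ultimately show ?thesis by (simp add: S_mult[of \<mu>] \<sigma>\<tau> word_element_eq)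
    qed
    moreover have "z (\<mu> \<otimes>\<^bsub>S\<^esub> \<epsilon>) h = z \<mu> (z \<epsilon> h)"
    proof (rule S.multiplicative[OF carrier(3,4)])
      \<comment> \<open>\<open>\<alpha> (s \<otimes> t)\<close> is defined on all of
        \<open>I\<close>, so the ideal required for the pair \<open>\<mu>\<close>,
        \<open>\<epsilon>\<close> is no smaller than \<open>I\<close> and contains what
        \<open>h\<close> needs.\<close>
      have "I \<subseteq> E (\<epsilon>\<^sup>\<star>\<^bsub>S\<^esub> \<otimes>\<^bsub>S\<^esub> \<mu>\<^sup>\<star>\<^bsub>S\<^esub>)"
      proof
        fix y assume y: "y \<in> I"
        then obtain v where "\<alpha> (s \<otimes> t) y = Some v" using \<alpha>st dom_st by (metis domD)
        then have "fst (\<mu>\<^sup>\<star>\<^bsub>S\<^esub>) v = Some y"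
          using s t \<alpha>_inverse[of "s \<otimes> t"] by (simp add: \<mu>_def star flip: single)
        then have "fst (\<epsilon> \<otimes>\<^bsub>S\<^esub> \<mu>\<^sup>\<star>\<^bsub>S\<^esub>) v = Some y"
          using y by (simp add: S_mult map_comp_Some_iff \<epsilon>_map)
        then show "y \<in> E (\<epsilon>\<^sup>\<star>\<^bsub>S\<^esub> \<otimes>\<^bsub>S\<^esub> \<mu>\<^sup>\<star>\<^bsub>S\<^esub>)"
          using carrier S.star_closed by (auto simp: E_eq_ran \<epsilon>_star ran_def)
      qed
      then have "ideal_product (E (\<epsilon>\<^sup>\<star>\<^bsub>S\<^esub>)) (E (\<epsilon>\<^sup>\<star>\<^bsub>S\<^esub> \<otimes>\<^bsub>S\<^esub> \<mu>\<^sup>\<star>\<^bsub>S\<^esub>)) = I"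
        using ideal_product_eq_Int[OF closed_ideal_E closed_ideal_E, of "\<epsilon>\<^sup>\<star>\<^bsub>S\<^esub>"
            "\<epsilon>\<^sup>\<star>\<^bsub>S\<^esub> \<otimes>\<^bsub>S\<^esub> \<mu>\<^sup>\<star>\<^bsub>S\<^esub>"]
          S.m_closed[OF S.star_closed[OF carrier(4)] S.star_closed[OF carrier(3)]] carrier(4)
        by (auto simp: \<epsilon>_star E\<epsilon>)
      then show "h \<in> rep_space \<rho> (ideal_product (E (\<epsilon>\<^sup>\<star>\<^bsub>S\<^esub>)) (E (\<epsilon>\<^sup>\<star>\<^bsub>S\<^esub> \<otimes>\<^bsub>S\<^esub> \<mu>\<^sup>\<star>\<^bsub>S\<^esub>)))"
        using h by (simp add: I_def)
    qed
    moreover have "z (\<sigma> \<otimes>\<^bsub>S\<^esub> \<tau>) h = z \<sigma> (z \<tau> h)"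
    proof (rule S.multiplicative[OF carrier(1,2)])
      have "\<tau>\<^sup>\<star>\<^bsub>S\<^esub> = element [t\<^sup>\<star>]" "\<sigma>\<^sup>\<star>\<^bsub>S\<^esub> = element [s\<^sup>\<star>]"
        using s t by (simp_all add: defs S_star word_star_def)
      moreover from this have "\<tau>\<^sup>\<star>\<^bsub>S\<^esub> \<otimes>\<^bsub>S\<^esub> \<sigma>\<^sup>\<star>\<^bsub>S\<^esub> = element [t\<^sup>\<star>, s\<^sup>\<star>]" by (simp flip: element_append)
      moreover have "E (element [t\<^sup>\<star>]) = D (t\<^sup>\<star>)" using E t star_closed by (simp flip: single)
      moreover have "E (element [t\<^sup>\<star>, s\<^sup>\<star>]) = I" using s t by (simp add: E_element star_closed I I_def)
      moreover have "ideal_product (D (t\<^sup>\<star>)) I = I"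
        using s t by (subst ideal_product_eq_Int)
          (auto simp: I_def closed_ideal_D star_closed intro!: closed_ideal_Int)
      ultimately show "h \<in> rep_space \<rho> (ideal_product (E (\<tau>\<^sup>\<star>\<^bsub>S\<^esub>)) (E (\<tau>\<^sup>\<star>\<^bsub>S\<^esub> \<otimes>\<^bsub>S\<^esub> \<sigma>\<^sup>\<star>\<^bsub>S\<^esub>)))"
        using h by (simp add: I_def)
    qed
    ultimately show "z (\<alpha> (s \<otimes> t), u (s \<otimes> t)) h = z (\<alpha> s, u s) (z (\<alpha> t, u t) h)"
      using z\<epsilon> by (simp add: defs single)
  next
    fix g a
    assume g: "g \<in> carrier G" and a: "a \<in> D (g\<^sup>\<star>)"
    then have "a \<in> E ((\<alpha> g, u g)\<^sup>\<star>\<^bsub>S\<^esub>)" by (simp add: star E star_closed)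
    from S.covariance[OF mem[OF g] this]
    show "z (\<alpha> g, u g) \<circ> \<rho> a \<circ> z (\<alpha> (g\<^sup>\<star>), u (g\<^sup>\<star>)) = \<rho> (the (\<alpha> g a))"
      by (simp add: star[OF g] \<beta>_of_def)
  next
    fix s
    assume s: "s \<in> carrier G"
    show "is_adjoint (z (\<alpha> (s\<^sup>\<star>), u (s\<^sup>\<star>))) (z (\<alpha> s, u s))"
      using S.adjoint[OF mem[OF s]] by (simp add: star[OF s])
  qed (simp_all add: S.representation S.nondegenerate mem S.partial_isometry S.initial_space
      S.final_space star E star_closed)
qed

end

theorem proposition2p11:
  fixes G :: "('g, 'm) monoid_scheme"
    and D :: "'g \<Rightarrow> 'a::cstar_algebra set"
    and \<alpha> :: "'g \<Rightarrow> 'a \<rightharpoonup> 'a"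
    and \<pi> :: "'a \<Rightarrow> 'h::complex_hilbert \<Rightarrow> 'h"
    and u :: "'g \<Rightarrow> 'h \<Rightarrow> 'h"
  assumes "partial_action G D \<alpha>"
    and "covariant_representation G D \<alpha> \<pi> u"
  shows "covariant_representation (S_of G \<alpha> u) (E_of G D \<alpha> u) \<beta>_of \<pi> \<nu>_of \<and>
    (\<forall>(\<rho> :: 'a \<Rightarrow> 'k::complex_hilbert \<Rightarrow> 'k) z.
       covariant_representation (S_of G \<alpha> u) (E_of G D \<alpha> u) \<beta>_of \<rho> z \<longrightarrow>
       covariant_representation G D \<alpha> \<rho> (\<lambda>g. z (\<alpha> g, u g)))"
proof (intro conjI allI impI)
  interpret covariant_representation G D \<alpha> \<pi> u by (rule assms(2))
  show "covariant_representation (S_of G \<alpha> u) (E_of G D \<alpha> u) \<beta>_of \<pi> \<nu>_of"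
    by (rule covariant_representation_S)
  show "covariant_representation G D \<alpha> \<rho> (\<lambda>g. z (\<alpha> g, u g))"
    if "covariant_representation (S_of G \<alpha> u) (E_of G D \<alpha> u) \<beta>_of \<rho> z"
    for \<rho> :: "'a \<Rightarrow> 'k \<Rightarrow> 'k" and z
    using that by (rule covariant_representation_restrict)
qed

end
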